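(* Let $p\ge 3$ be a prime and let $k$ be a divisor of $p-1$ with $1\le k<p-1$; write $p-1=kn$. Let $\chi$ be any generator of the cyclic group $\widehat{\mathbb{F}_p^{\times}}$ of multiplicative characters of $\mathbb{F}_p$. Define the $(n-1)\times(n-1)$ matrix $$X_{p,\chi}(k)=\left[J_p(\chi^{ki},\chi^{kj})\right]_{1\le i,j\le n-1}$$ and the $n\times n$ matrix $$Y_{p,\chi}(k)=\left[J_p(\chi^{ki},\chi^{kj})\right]_{0\le i,j\le n-1}.$$ Let $\zeta_p\in\mathbb{C}$ be a primitive $p$-th root of unity, let $U_k(\mathbb{F}_p)=\{x\in\mathbb{F}_p^{\times}: x^k=1\}$, let $\theta_k=\sum_{x\in U_k(\mathbb{F}_p)}\zeta_p^{x}$, and let $P_k(T)\in\mathbb{Z}[T]$ be the minimal polynomial of $\theta_k$ over $\mathbb{Q}$. Let $x_p(k)$ be the coefficient of $T$ in $P_k(T)$ and $y_p(k)$ its constant term. Then $$\det X_{p,\chi}(k)=(-1)^{\frac{(k+1)(n^2-n)}{2}}\cdot n^{n-2}\cdot x_p(k),$$ and $$\det Y_{p,\chi}(k)=\frac{1}{p}\cdot(-1)^{\frac{(k+1)(n^2-n)}{2}}\cdot n^{n}\cdot\left(k^2x_p(k)-y_p(k)\right).$$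
   Context: Every multiplicative character $A:\mathbb{F}_p^{\times}\to\mathbb{C}^{\times}$ is extended to $\mathbb{F}_p$ by setting $A(0)=0$ (including the trivial character). For characters $A,B$, the Jacobi sum is $J_p(A,B)=\sum_{x\in\mathbb{F}_p}A(x)B(1-x)$. In the exponent $\zeta_p^{x}$, $x\in\mathbb{F}_p$ is identified with an integer representative (the value is independent of the choice). *)

theory Defs
  imports
    Complex_Main
    "HOL-Algebra.Elementary_Groups"
    "Jordan_Normal_Form.Determinant"
    "Berlekamp_Zassenhaus.Finite_Field"
begin

text \<open>
  Throughout, the field with \<open>p\<close> elements is the type \<^typ>\<open>'p::prime_card mod_ring\<close>, where
  \<open>p = CARD('p)\<close> is prime by the class constraint.
\<close>

text \<open>
  A homomorphism from the nonzero elements to the nonzero complex numbers, extended by zero.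
  This includes the trivial character, which is therefore the indicator function of \<open>x \<noteq> 0\<close>
  and not the constant function 1.
\<close>

definition mult_char :: "('p::prime_card mod_ring \<Rightarrow> complex) \<Rightarrow> bool" where
  "mult_char A \<longleftrightarrow>
     A 0 = 0 \<and> (\<forall>x. x \<noteq> 0 \<longrightarrow> A x \<noteq> 0) \<and>
     (\<forall>x y. x \<noteq> 0 \<longrightarrow> y \<noteq> 0 \<longrightarrow> A (x * y) = A x * A y)"

definition char_group :: "('p::prime_card mod_ring \<Rightarrow> complex) monoid" where
  "char_group = \<lparr>carrier = {A. mult_char A},
                 mult = (\<lambda>A B x. A x * B x),
                 one = (\<lambda>x. if x = 0 then 0 else 1)\<rparr>"

text \<open>The same notion of generator as in \<^const>\<open>cyclic_group\<close>.\<close>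

definition generates_group :: "('a, 'b) monoid_scheme \<Rightarrow> 'a \<Rightarrow> bool" where
  "generates_group G g \<longleftrightarrow> g \<in> carrier G \<and> subgroup_generated G {g} = G"

definition jacobi_sum ::
    "('p::prime_card mod_ring \<Rightarrow> complex) \<Rightarrow> ('p mod_ring \<Rightarrow> complex) \<Rightarrow> complex" where
  "jacobi_sum A B = (\<Sum>x\<in>UNIV. A x * B (1 - x))"

text \<open>
  Matrix indices start at 0, so the entry at position \<open>(i, j)\<close> of \<open>X_mat\<close> carries the
  indices \<open>i + 1\<close> and \<open>j + 1\<close>. Powers are taken in the character group; in particular the
  zeroth power is the trivial character, which vanishes at 0.
\<close>

definition X_mat :: "('p::prime_card mod_ring \<Rightarrow> complex) \<Rightarrow> nat \<Rightarrow> nat \<Rightarrow> complex mat" where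
  "X_mat chi k n = mat (n - 1) (n - 1) (\<lambda>(i, j).
     jacobi_sum (chi [^]\<^bsub>char_group\<^esub> (k * (i + 1))) (chi [^]\<^bsub>char_group\<^esub> (k * (j + 1))))"

definition Y_mat :: "('p::prime_card mod_ring \<Rightarrow> complex) \<Rightarrow> nat \<Rightarrow> nat \<Rightarrow> complex mat" where
  "Y_mat chi k n = mat n n (\<lambda>(i, j).
     jacobi_sum (chi [^]\<^bsub>char_group\<^esub> (k * i)) (chi [^]\<^bsub>char_group\<^esub> (k * j)))"

definition primitive_root_of_unity :: "nat \<Rightarrow> complex \<Rightarrow> bool" where
  "primitive_root_of_unity m z \<longleftrightarrow> m > 0 \<and> z ^ m = 1 \<and> (\<forall>l. 0 < l \<and> l < m \<longrightarrow> z ^ l \<noteq> 1)"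

definition U_set :: "nat \<Rightarrow> 'p::prime_card mod_ring set" where
  "U_set k = {x. x \<noteq> 0 \<and> x ^ k = 1}"

text \<open>
  The type argument fixes the field over which the sum runs. The exponent is the representative
  in \<open>{0..<p}\<close>.
\<close>

definition gauss_period :: "'p::prime_card itself \<Rightarrow> complex \<Rightarrow> nat \<Rightarrow> complex" where
  "gauss_period _ z k = (\<Sum>x\<in>(U_set k :: 'p mod_ring set). z powi to_int_mod_ring x)"

text \<open>The minimal polynomial over the rationals: meaningful for algebraic numbers only.\<close>

definition is_min_poly :: "rat poly \<Rightarrow> complex \<Rightarrow> bool" where
  "is_min_poly P z \<longleftrightarrow>
     lead_coeff P = 1 \<and> poly (map_poly of_rat P) z = 0 \<and>
     (\<forall>Q. Q \<noteq> 0 \<and> poly (map_poly of_rat Q) z = 0 \<longrightarrow> degree P \<le> degree Q)"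

definition min_poly :: "complex \<Rightarrow> rat poly" where
  "min_poly z = (THE P. is_min_poly P z)"


lemma carrier_char_group: "A \<in> carrier char_group \<longleftrightarrow> mult_char A"
  by (simp add: char_group_def)

lemma comm_group_char_group: "comm_group (char_group :: ('p::prime_card mod_ring \<Rightarrow> complex) monoid)"
proof (rule comm_groupI)
  fix A :: "'p mod_ring \<Rightarrow> complex"
  assume "A \<in> carrier char_group"
  then have A: "mult_char A" by (simp add: char_group_def)
  have "mult_char (\<lambda>x. inverse (A x))"
    using A by (auto simp: mult_char_def)
  moreover have "(\<lambda>x. inverse (A x) * A x) = (\<lambda>x. if x = 0 then 0 else 1)"
    using A by (auto simp: mult_char_def fun_eq_iff)
  ultimately show "\<exists>B\<in>carrier char_group. B \<otimes>\<^bsub>char_group\<^esub> A = \<one>\<^bsub>char_group\<^esub>"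
    by (auto simp: char_group_def intro!: exI[of _ "\<lambda>x. inverse (A x)"])
qed (auto simp: char_group_def mult_char_def fun_eq_iff)

lemma char_group_pow:
  "(A [^]\<^bsub>char_group\<^esub> (m::nat)) x = (if x = 0 \<and> m = 0 then 0 else A x ^ m)"
  if "A \<in> carrier char_group"
  using that
  by (induction m) (auto simp: char_group_def mult_char_def)

lemma generates_group_char_group_iff:
  fixes chi :: "'p::prime_card mod_ring \<Rightarrow> complex"
  shows "generates_group char_group chi \<longleftrightarrow>
    mult_char chi \<and> (\<forall>A. mult_char A \<longrightarrow> (\<exists>m::int. A = chi [^]\<^bsub>char_group\<^esub> m))"
proof -
  interpret comm_group "char_group :: ('p mod_ring \<Rightarrow> complex) monoid"
    by (rule comm_group_char_group)
  have eq: "subgroup_generated char_group {chi} = char_group \<longleftrightarrow>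
      carrier (subgroup_generated char_group {chi}) = carrier char_group"
    by (metis (no_types, lifting) monoid.surjective monoid.update_convs(1) partial_object.update_convs(1)
        subgroup_generated_def partial_object.select_convs(1))
  show ?thesis
  proof (cases "chi \<in> carrier char_group")
    case True
    then show ?thesis
      unfolding generates_group_def eq carrier_subgroup_generated_by_singleton[OF True]
      by (auto simp flip: carrier_char_group)
  qed (simp add: generates_group_def carrier_char_group)
qed

lemma is_min_poly_unique:
  assumes "is_min_poly P z" "is_min_poly Q z"
  shows "P = Q"
proof (rule ccontr)
  assume "P \<noteq> Q"
  then have nz: "P - Q \<noteq> 0" by simp
  have deg: "degree P = degree Q"
    using assms unfolding is_min_poly_def
    by (metis antisym leading_coeff_0_iff one_neq_zero)
  have hom: "map_poly of_rat (P - Q) = map_poly of_rat P - (map_poly of_rat Q :: complex poly)"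
    by (intro poly_eqI) (simp add: coeff_map_poly of_rat_diff)
  have le: "degree P \<le> degree (P - Q)"
    using assms nz by (auto simp: is_min_poly_def hom)
  moreover have "degree (P - Q) \<le> degree P"
    using deg by (simp add: degree_diff_le)
  moreover have "Polynomial.coeff (P - Q) (degree P) = 0"
    using assms deg by (simp add: is_min_poly_def)
  ultimately show False
    using nz by (metis antisym leading_coeff_0_iff)
qed

lemma min_poly_eqI: "is_min_poly P z \<Longrightarrow> min_poly z = P"
  unfolding min_poly_def using is_min_poly_unique by blast

lemma is_min_poly_min_poly:
  assumes "Q \<noteq> 0" "poly (map_poly of_rat Q) z = 0"
  shows "is_min_poly (min_poly z) z"
proof -
  define S where "S = (\<lambda>Q :: rat poly. Q \<noteq> 0 \<and> poly (map_poly of_rat Q) z = 0)"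
  define R where "R = (ARG_MIN degree Q. S Q)"
  have S: "S R"
    unfolding R_def by (rule arg_min_natI[of S Q]) (use assms in \<open>auto simp: S_def\<close>)
  have min: "degree R \<le> degree T" if "S T" for T
    unfolding R_def using that by (rule arg_min_nat_le)
  define P where "P = smult (inverse (lead_coeff R)) R"
  have "map_poly of_rat P = smult (of_rat (inverse (lead_coeff R))) (map_poly of_rat R :: complex poly)"
    by (intro poly_eqI) (simp add: P_def coeff_map_poly of_rat_mult)
  then have "is_min_poly P z"
    using S min by (auto simp: is_min_poly_def S_def P_def)
  then show ?thesis
    using min_poly_eqI by metis
qed

end

theory Submission
  imports
    Defs
    "Jordan_Normal_Form.Char_Poly"
    "Berlekamp_Zassenhaus.Factor_Bound"
    "HOL-Number_Theory.Residue_Primitive_Roots"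
begin

text \<open>
  Put \<open>\<psi> = \<chi>\<^sup>k\<close>, a character of order \<open>n\<close> with kernel \<open>U\<^sub>k\<close>. With the Gauss sums \<open>g\<^sub>i\<close> of \<open>\<psi>\<^sup>i\<close>, every
  Jacobi sum is \<open>g\<^sub>i g\<^sub>j cnj (g\<^sub>i\<^sub>+\<^sub>j) / p\<close>, except that \<open>(p - 1)\<^sup>2 / p\<close> has to be added at \<open>i = j = 0\<close>.
  The Gauss sums are the discrete Fourier transform of the Gaussian periods \<open>\<eta>\<^sub>t\<close> (the sums of \<open>\<zeta>\<^sup>x\<close>
  over the fibres of \<open>\<psi>\<close>), so for every \<open>s\<close> the matrix with \<open>s\<close> added in the corner factors as
  \<open>V (diag (cnj \<eta>\<^sub>t / p) + (s / n\<^sup>2) J) V\<^sup>T\<close>, where \<open>J\<close> is the all-ones matrix. Its determinant is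
  affine in \<open>s\<close>: the value at \<open>s = (p - 1)\<^sup>2 / p\<close> gives \<open>det Y\<close>, and the slope is the corner minor
  \<open>det X\<close>. Both are expressed by the two highest elementary symmetric functions of the periods,
  i.e. by the two lowest coefficients of \<open>\<Prod> (T - \<eta>\<^sub>t)\<close>.

  That this product is the minimal polynomial of \<open>\<theta> = \<eta>\<^sub>0\<close> and has integer coefficients is seen as
  follows. Multiplication by \<open>\<eta>\<^sub>s\<close> acts on the vector \<open>(\<eta>\<^sub>s\<^sub>+\<^sub>t)\<^sub>t\<close> through an integer matrix independent of
  \<open>s\<close>, whose characteristic polynomial therefore has all the \<open>\<eta>\<^sub>s\<close> as roots. By irreducibility of the
  \<open>p\<close>-th cyclotomic polynomial, every rational polynomial vanishing at \<open>\<eta>\<^sub>0\<close> vanishes at all \<open>\<eta>\<^sub>s\<close>, and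
  these are distinct because \<open>g\<^sub>1 \<noteq> 0\<close>.
\<close>

section \<open>Determinants\<close>

lemma cofactor_cong_row:
  assumes "A \<in> carrier_mat n n" "B \<in> carrier_mat n n" "j < n"
    and "\<And>i' j'. i' < n \<Longrightarrow> j' < n \<Longrightarrow> i' \<noteq> i \<Longrightarrow> A $$ (i', j') = B $$ (i', j')"
  shows "cofactor A i j = cofactor B i j"
proof -
  have "mat_delete A i j = mat_delete B i j"
    by (rule eq_matI) (use assms in \<open>auto simp: mat_delete_def\<close>)
  then show ?thesis by (simp add: cofactor_def)
qed

text \<open>Only the entry (0, 0) depends on \<open>s\<close>, and its cofactor does not, so
  expansion along row 0 is affine in \<open>s\<close>, with the corner minor as slope.\<close>

lemma det_add_corner:
  fixes s :: "'a::comm_ring_1"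
  assumes "0 < n"
  shows "Determinant.det (mat n n (\<lambda>(i, j). a i j + (if i = 0 \<and> j = 0 then s else 0))) =
    Determinant.det (mat n n (\<lambda>(i, j). a i j)) +
    s * Determinant.det (mat (n - 1) (n - 1) (\<lambda>(i, j). a (i + 1) (j + 1)))"
proof -
  let ?A = "mat n n (\<lambda>(i, j). a i j)"
  let ?B = "mat n n (\<lambda>(i, j). a i j + (if i = 0 \<and> j = 0 then s else 0))"
  have del: "mat_delete ?A 0 0 = mat (n - 1) (n - 1) (\<lambda>(i, j). a (i + 1) (j + 1))"
    by (rule eq_matI) (auto simp: mat_delete_def)
  have "Determinant.det ?B = (\<Sum>j<n. ?B $$ (0, j) * cofactor ?B 0 j)"
    by (rule laplace_expansion_row) (use assms in auto)
  also have "\<dots> = (\<Sum>j<n. (a 0 j + (if j = 0 then s else 0)) * cofactor ?A 0 j)"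
    by (intro sum.cong refl arg_cong2[where f = "(*)"] cofactor_cong_row) (use assms in auto)
  also have "\<dots> = (\<Sum>j<n. ?A $$ (0, j) * cofactor ?A 0 j) + (\<Sum>j<n. if j = 0 then s * cofactor ?A 0 j else 0)"
    unfolding sum.distrib [symmetric] by (intro sum.cong refl) (use assms in \<open>auto simp: algebra_simps\<close>)
  also have "(\<Sum>j<n. ?A $$ (0, j) * cofactor ?A 0 j) = Determinant.det ?A"
    by (rule laplace_expansion_row [symmetric]) (use assms in auto)
  also have "(\<Sum>j<n. if j = 0 then s * cofactor ?A 0 j else 0) = s * cofactor ?A 0 0"
    using assms by (simp add: sum.delta)
  finally show ?thesis
    by (simp add: cofactor_def del)
qed

text \<open>Row 0 has its only nonzero entry in the last column. Each expansion step thus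
  contributes a sign with exponent one less than the current size, and these exponents add up to
  m(m-1)/2.\<close>

lemma det_antidiagonal:
  fixes c :: "nat \<Rightarrow> 'a::comm_ring_1"
  shows "Determinant.det (mat m m (\<lambda>(i, j). if i + j + 1 = m then c j else 0)) =
    (-1) ^ (m * (m - 1) div 2) * (\<Prod>j<m. c j)"
proof (induction m)
  case 0
  then show ?case by simp
next
  case (Suc m)
  let ?A = "\<lambda>m. mat m m (\<lambda>(i, j). if i + j + 1 = m then c j else 0)"
  have del: "mat_delete (?A (Suc m)) 0 m = ?A m"
    by (rule eq_matI) (auto simp: mat_delete_def)
  have "Determinant.det (?A (Suc m)) = (\<Sum>j<Suc m. ?A (Suc m) $$ (0, j) * cofactor (?A (Suc m)) 0 j)"
    by (rule laplace_expansion_row) auto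
  also have "\<dots> = (\<Sum>j<Suc m. if j = m then c j * cofactor (?A (Suc m)) 0 j else 0)"
    by (intro sum.cong refl) auto
  also have "\<dots> = c m * cofactor (?A (Suc m)) 0 m"
    by (simp add: sum.delta)
  also have "\<dots> = (-1) ^ (m + m * (m - 1) div 2) * (\<Prod>j<Suc m. c j)"
    unfolding cofactor_def del Suc.IH by (simp add: power_add mult_ac)
  also have "m + m * (m - 1) div 2 = Suc m * (Suc m - 1) div 2"
    by (cases m) auto
  finally show ?case .
qed

text \<open>For indices below \<open>n\<close>, the sum i + j is divisible by \<open>n\<close> only
  if it is 0 or \<open>n\<close>: a corner entry and an antidiagonal block of size
  \<open>n - 1\<close>. Orthogonality of roots of unity produces this shape in
  \<open>det_gauss_mat\<close>.\<close>

lemma det_index_sum_dvd: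
  fixes c :: "nat \<Rightarrow> 'a::comm_ring_1"
  assumes "0 < n"
  shows "Determinant.det (mat n n (\<lambda>(i, j). if n dvd i + j then c j else 0)) =
    (-1) ^ ((n - 1) * (n - 2) div 2) * (\<Prod>j<n. c j)"
proof -
  obtain m where n: "n = Suc m" using assms gr0_implies_Suc by blast
  let ?A = "mat n n (\<lambda>(i, j). if n dvd i + j then c j else 0)"
  \<comment> \<open>Deleting row and column 0 shifts both indices by one, which accounts for the
    2.\<close>
  have dvd: "n dvd i + j + 2 \<longleftrightarrow> i + j + 1 = m" if "i < m" "j < m" for i j
  proof
    assume "n dvd i + j + 2"
    then obtain q where q: "i + j + 2 = n * q" by (elim dvdE)
    have "n * q < n * 2" unfolding q [symmetric] using that n by simp
    then have "q < 2" by simp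
    with q have "q = 1" by (cases q) auto
    with q n show "i + j + 1 = m" by simp
  qed (simp add: n)
  have del: "mat_delete ?A 0 0 = mat m m (\<lambda>(i, j). if i + j + 1 = m then c (Suc j) else 0)"
    by (rule eq_matI) (use dvd in \<open>auto simp: mat_delete_def n\<close>)
  have "Determinant.det ?A = (\<Sum>j<n. ?A $$ (0, j) * cofactor ?A 0 j)"
    by (rule laplace_expansion_row) (use n in auto)
  also have "\<dots> = (\<Sum>j<n. if j = 0 then c 0 * cofactor ?A 0 j else 0)"
    by (intro sum.cong refl) (auto dest: dvd_imp_le)
  also have "\<dots> = c 0 * cofactor ?A 0 0"
    using assms by (simp add: sum.delta)
  also have "cofactor ?A 0 0 = (-1) ^ (m * (m - 1) div 2) * (\<Prod>j<m. c (Suc j))"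
    unfolding cofactor_def del det_antidiagonal by simp
  finally show ?thesis
    by (simp add: n prod.lessThan_Suc_shift mult_ac del: prod.lessThan_Suc)
qed

text \<open>Induction by expanding along the last row, which is \<open>c\<close> times the all-ones
  row plus \<open>d n\<close> at the end. The all-ones part needs the sum of the last-row cofactors,
  which is the determinant of \<open>?B\<close>, where that row is replaced by ones.\<close>

lemma det_diag_plus_const:
  fixes c :: "'a::comm_ring_1"
  shows "Determinant.det (mat n n (\<lambda>(i, j). (if i = j then d i else 0) + c)) =
    (\<Prod>i<n. d i) + c * (\<Sum>i<n. \<Prod>j\<in>{..<n} - {i}. d j)"
proof (induction n)
  case 0
  then show ?case by simp
next
  case (Suc n)
  let ?A = "\<lambda>n. mat n n (\<lambda>(i, j). (if i = j then d i else 0) + c)"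
  let ?B = "mat (Suc n) (Suc n) (\<lambda>(i, j). if i = n then 1 else (if i = j then d i else 0) + c)"
  let ?U = "mat (Suc n) (Suc n) (\<lambda>(i, j). (if i = j then 1 else 0) + (if i < n \<and> j = n then c else 0))"
  let ?T = "mat (Suc n) (Suc n) (\<lambda>(i, j). if i = n then 1 else if i = j then d i else 0)"
  have U: "Determinant.det ?U = 1"
    by (subst det_upper_triangular[where n = "Suc n"]) (auto simp: prod_list_diag_prod)
  have T: "Determinant.det ?T = (\<Prod>i<n. d i)"
    by (subst det_lower_triangular[where n = "Suc n"])
      (auto simp: prod_list_diag_prod lessThan_atLeast0 intro!: prod.cong)
  \<comment> \<open>Subtracting \<open>c\<close> times the all-ones last row from the other rows
    removes the constant; \<open>?U\<close> undoes these operations and \<open>?T\<close> is what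
    remains.\<close>
  have "?B = ?U * ?T"
  proof (rule eq_matI)
    fix i j assume ij: "i < dim_row (?U * ?T)" "j < dim_col (?U * ?T)"
    then have "(?U * ?T) $$ (i, j) = (\<Sum>l<Suc n. ((if i = l then 1 else 0) + (if i < n \<and> l = n then c else 0)) *
        (if l = n then 1 else if l = j then d l else 0))"
      by (simp add: scalar_prod_def lessThan_atLeast0 del: sum.op_ivl_Suc)
    also have "\<dots> = (\<Sum>l<Suc n. (if l = i then (if l = n then 1 else if l = j then d l else 0) else 0) +
        (if l = n then (if i < n then c else 0) else 0))"
      by (intro sum.cong refl) auto
    also have "\<dots> = ?B $$ (i, j)"
      unfolding sum.distrib using ij by (simp del: sum.lessThan_Suc)
    finally show "?B $$ (i, j) = (?U * ?T) $$ (i, j)" ..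
  qed auto
  then have B: "Determinant.det ?B = (\<Prod>i<n. d i)"
    using det_mult[of ?U "Suc n" ?T] U T by simp
  have "Determinant.det ?B = (\<Sum>j<Suc n. ?B $$ (n, j) * cofactor ?B n j)"
    by (rule laplace_expansion_row) auto
  also have "\<dots> = (\<Sum>j<Suc n. cofactor (?A (Suc n)) n j)"
    by (intro sum.cong refl, subst cofactor_cong_row[where B = "?A (Suc n)" and n = "Suc n"]) auto
  finally have cof: "(\<Sum>j<Suc n. cofactor (?A (Suc n)) n j) = (\<Prod>i<n. d i)"
    using B by simp
  have del: "mat_delete (?A (Suc n)) n n = ?A n"
    by (rule eq_matI) (auto simp: mat_delete_def)
  have "Determinant.det (?A (Suc n)) = (\<Sum>j<Suc n. ?A (Suc n) $$ (n, j) * cofactor (?A (Suc n)) n j)"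
    by (rule laplace_expansion_row) auto
  also have "\<dots> = (\<Sum>j<Suc n. c * cofactor (?A (Suc n)) n j + (if j = n then d n * cofactor (?A (Suc n)) n j else 0))"
    by (intro sum.cong refl) (auto simp: algebra_simps)
  also have "\<dots> = c * (\<Sum>j<Suc n. cofactor (?A (Suc n)) n j) + d n * cofactor (?A (Suc n)) n n"
    unfolding sum.distrib sum_distrib_left by (simp del: sum.lessThan_Suc)
  also have "\<dots> = c * (\<Prod>i<n. d i) + d n * Determinant.det (?A n)"
    unfolding cof by (simp add: cofactor_def del)
  finally have main: "Determinant.det (?A (Suc n)) = c * (\<Prod>i<n. d i) + d n * Determinant.det (?A n)" .
  have "(\<Prod>j\<in>{..<Suc n} - {i}. d j) = d n * (\<Prod>j\<in>{..<n} - {i}. d j)" if "i < n" for i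
  proof -
    have "{..<Suc n} - {i} = insert n ({..<n} - {i})" using that by auto
    then show ?thesis by simp
  qed
  moreover have "{..<Suc n} - {n} = {..<n}" by auto
  ultimately show ?case
    unfolding main Suc.IH by (simp add: sum_distrib_left algebra_simps)
qed

section \<open>The cyclotomic polynomial of prime index\<close>

text \<open>Polymorphic in the coefficient ring, since the polynomial is needed over the integers,
  the rationals, the complex numbers and the field with \<open>p\<close> elements.\<close>

definition prime_cyclotomic :: "nat \<Rightarrow> 'a::comm_ring_1 poly" where
  "prime_cyclotomic p = (\<Sum>i<p. [:0, 1:] ^ i)"

lemma poly_prime_cyclotomic: "poly (prime_cyclotomic p) z = (\<Sum>i<p. z ^ i)"
  by (simp add: prime_cyclotomic_def poly_sum)

lemma prime_cyclotomic_mult: "[:-1, 1:] * prime_cyclotomic p = [:0, 1:] ^ p - (1 :: 'a::comm_ring_1 poly)"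
proof -
  have "[:-1, 1:] = [:0, 1:] - (1 :: 'a poly)"
    by (rule poly_eqI) (simp add: coeff_pCons split: nat.split)
  then show ?thesis
    unfolding prime_cyclotomic_def power_diff_1_eq by (simp only:)
qed

lemma map_poly_of_int_prime_cyclotomic:
  "map_poly of_int (prime_cyclotomic p) = prime_cyclotomic p"
  by (simp add: prime_cyclotomic_def of_int_poly_hom.hom_sum of_int_poly_hom.hom_power)

lemma map_poly_of_rat_prime_cyclotomic:
  "map_poly of_rat (prime_cyclotomic p) = (prime_cyclotomic p :: complex poly)"
proof -
  interpret map_poly_comm_ring_hom "of_rat :: rat \<Rightarrow> complex" ..
  show ?thesis
    by (simp add: prime_cyclotomic_def hom_sum hom_power)
qed

lemma lead_coeff_degree_prime_cyclotomic:
  assumes "p > 0"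
  shows "lead_coeff (prime_cyclotomic p :: int poly) = 1" "degree (prime_cyclotomic p :: int poly) = p - 1"
proof -
  have X: "[:0, 1:] ^ p = (Polynomial.monom 1 p :: int poly)"
    by (simp add: monom_altdef)
  have "degree (- 1 :: int poly) < degree (Polynomial.monom 1 p :: int poly)"
    using assms by (simp add: degree_monom_eq)
  then have deg: "degree ([:0, 1:] ^ p - 1 :: int poly) = p"
    unfolding X using degree_add_eq_left[of "-1" "Polynomial.monom (1 :: int) p"] assms
    by (simp add: degree_monom_eq)
  then have "lead_coeff ([:0, 1:] ^ p - 1 :: int poly) = 1"
    unfolding X using assms by simp
  then show "lead_coeff (prime_cyclotomic p :: int poly) = 1"
    unfolding prime_cyclotomic_mult [symmetric] lead_coeff_mult by simp
  then have "prime_cyclotomic p \<noteq> (0 :: int poly)"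
    by auto
  then have "degree ([:-1, 1:] * prime_cyclotomic p :: int poly) = 1 + degree (prime_cyclotomic p :: int poly)"
    by (subst degree_mult_eq) auto
  then show "degree (prime_cyclotomic p :: int poly) = p - 1"
    unfolding prime_cyclotomic_mult deg by simp
qed

text \<open>
  Modulo \<open>p\<close> the polynomial \<open>X\<^sup>p - 1\<close> is \<open>(X - 1)\<^sup>p\<close>, so both factors of a factorization would vanish
  at 1 modulo \<open>p\<close>, whereas the value there is \<open>p\<close>, which is not divisible by \<open>p\<^sup>2\<close>.
\<close>
lemma irreducible_prime_cyclotomic_int:
  "irreducible\<^sub>d (prime_cyclotomic (CARD('p::prime_card)) :: int poly)"
proof (rule irreducible\<^sub>dI)
  let ?p = "CARD('p)"
  let ?F = "prime_cyclotomic ?p :: int poly"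
  have p: "prime ?p" by (rule prime_card)
  then have p1: "?p > 1" by (rule prime_gt_1_nat)
  then show "degree ?F > 0" by (simp add: lead_coeff_degree_prime_cyclotomic)
  have root: "int ?p dvd poly q 1" if deg: "degree q > 0" and qr: "?F = q * r" for q r
  proof -
    let ?h = "map_poly of_int :: int poly \<Rightarrow> 'p mod_ring poly"
    let ?X = "[:-1, 1:] :: 'p mod_ring poly"
    \<comment> \<open>The leading coefficient of \<open>q\<close> is a unit, so reduction modulo
      \<open>p\<close> preserves the degree and \<open>?h q\<close> is not a unit.\<close>
    have "lead_coeff q * lead_coeff r = 1"
      using lead_coeff_degree_prime_cyclotomic(1)[of ?p] p1 by (simp add: qr lead_coeff_mult)
    then have "\<bar>lead_coeff q\<bar> = 1"
      by (metis dvd_triv_left zdvd1_eq)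
    then have "lead_coeff q = 1 \<or> lead_coeff q = -1" by linarith
    then have "of_int (lead_coeff q) \<noteq> (0 :: 'p mod_ring)" by auto
    then have "degree (?h q) = degree q" by (rule map_poly_degree_eq)
    with deg have "degree (?h q) > 0" by simp
    then have nu: "\<not> is_unit (?h q)" using is_unit_iff_degree[of "?h q"] by force
    have "?X ^ ?p = [:0, 1:] ^ ?p + (-1) ^ ?p"
    proof -
      have "?X = [:0, 1:] + (-1)"
        by (rule poly_eqI) (simp add: coeff_pCons split: nat.split)
      moreover have "([:0, 1:] + (-1)) ^ ?p = [:0, 1:] ^ ?p + (- 1 :: 'p mod_ring poly) ^ ?p"
        by (rule freshmans_dream) (use p in auto)
      ultimately show ?thesis by metis
    qed
    also have "(-1 :: 'p mod_ring poly) ^ ?p = -1"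
    \<comment> \<open>For \<open>p = 2\<close> the power is 1, which equals -1 in characteristic
      2.\<close>
    proof (cases "?p = 2")
      case True
      have "(of_nat ?p :: 'p mod_ring poly) = 0" using of_nat_card_eq_0 by (metis of_nat_0 of_nat_poly pCons_0_0)
      then have "(2 :: 'p mod_ring poly) = 0" using True by simp
      then show ?thesis using True by (simp add: eq_neg_iff_add_eq_0)
    next
      case False
      then have "odd ?p" using p prime_odd_nat p1 by (metis dual_order.order_iff_strict prime_ge_2_nat)
      then show ?thesis by simp
    qed
    finally have "?X ^ ?p = ?X * prime_cyclotomic ?p" by (simp only: prime_cyclotomic_mult diff_conv_add_uminus)
    also have "\<dots> = ?X * ?h ?F"
      by (simp only: map_poly_of_int_prime_cyclotomic)
    also have "?h ?F = ?h q * ?h r" unfolding qr by (rule of_int_poly_hom.hom_mult)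
    finally have "?h q dvd ?X ^ ?p" by (metis dvd_triv_left dvd_mult)
    \<comment> \<open>A nonunit dividing a power of the prime element \<open>?X\<close> cannot be
      coprime to \<open>?X\<close>.\<close>
    have "?X dvd ?h q"
    proof (rule ccontr)
      assume "\<not> ?X dvd ?h q"
      moreover have "prime_elem ?X" by (rule prime_elem_linear_field_poly) simp
      ultimately have "Rings.coprime ?X (?h q)" by (metis prime_elem_imp_coprime)
      then have "Rings.coprime (?X ^ ?p) (?h q)" by (metis coprime_power_left_iff)
      with \<open>?h q dvd ?X ^ ?p\<close> nu show False
        by (metis coprime_common_divisor dvd_refl)
    qed
    then have "poly (?h q) 1 = 0" by (metis poly_eq_0_iff_dvd)
    then have "of_int (poly q 1) = (0 :: 'p mod_ring)"
      using of_int_hom.poly_map_poly[of q 1] by simp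
    then show ?thesis
      by (metis of_int_eq_0_iff_char_dvd semiring_char_mod_ring)
  qed
  fix q r :: "int poly"
  assume "degree q > 0" "degree r > 0" and qr: "?F = q * r"
  with root[of q r] root[of r q] have "int ?p * int ?p dvd poly q 1 * poly r 1"
    by (metis mult.commute mult_dvd_mono)
  also have "poly q 1 * poly r 1 = poly ?F 1" by (simp add: qr)
  also have "\<dots> = int ?p" by (simp add: poly_prime_cyclotomic)
  finally have "?p * ?p dvd ?p" by (metis int_dvd_int_iff of_nat_mult)
  then show False using p1 by (auto dest: dvd_imp_le)
qed

text \<open>This replaces the Galois action on the \<open>p\<close>-th roots of unity: an
  irreducible polynomial with root \<open>z\<close> divides every rational \<open>Q\<close>
  vanishing at \<open>z\<close>, and \<open>z ^ a\<close> is another of its roots.\<close>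

lemma poly_of_rat_root_power:
  assumes z: "z ^ CARD('p::prime_card) = 1" "z \<noteq> 1" and a: "\<not> CARD('p) dvd a"
    and Q: "poly (map_poly of_rat Q) z = (0 :: complex)"
  shows "poly (map_poly of_rat Q) (z ^ a) = (0 :: complex)"
proof -
  let ?p = "CARD('p)"
  let ?F = "prime_cyclotomic ?p :: rat poly"
  interpret map_poly_comm_ring_hom "of_rat :: rat \<Rightarrow> complex" ..
  have root: "poly (map_poly of_rat ?F) w = 0" if "w ^ ?p = 1" "w \<noteq> 1" for w :: complex
    using that power_diff_1_eq[of w ?p] by (simp add: map_poly_of_rat_prime_cyclotomic poly_prime_cyclotomic)
  have irr: "irreducible ?F"
    using irreducible\<^sub>d_int_rat[OF irreducible_prime_cyclotomic_int[where 'p = 'p]]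
    by (simp add: map_poly_of_int_prime_cyclotomic)
  \<comment> \<open>Otherwise a Bezout relation evaluated at \<open>z\<close> would read 0 =
    1.\<close>
  have "?F dvd Q"
  proof (rule ccontr)
    assume "\<not> ?F dvd Q"
    with irr have "Rings.coprime ?F Q"
      by (metis field_poly_irreducible_imp_prime prime_elem_imp_coprime)
    then obtain u v where "u * ?F + v * Q = 1"
      by (metis bezout_coefficients_fst_snd coprime_iff_gcd_eq_1)
    then have "poly (map_poly of_rat (u * ?F + v * Q)) z = (1 :: complex)" by simp
    then show False using Q root[OF z] by (simp add: hom_add hom_mult)
  qed
  then obtain R where R: "Q = ?F * R" by (elim dvdE)
  \<comment> \<open>As \<open>a\<close> is invertible modulo \<open>p\<close>, \<open>z\<close> is
    itself a power of \<open>z ^ a\<close>.\<close>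
  have "z ^ a \<noteq> 1"
  proof
    assume "z ^ a = 1"
    have "Rings.coprime ?p a" using a prime_card[where 'a = 'p] by (rule prime_imp_coprime[rotated])
    then have "gcd a ?p = 1" by (metis coprime_iff_gcd_eq_1 gcd.commute)
    moreover have "a \<noteq> 0" using a by (metis dvd_0_right)
    ultimately obtain x y where "a * x = ?p * y + 1"
      using bezout_nat[of a ?p] by metis
    then have "(z ^ a) ^ x = (z ^ ?p) ^ y * z" by (simp flip: power_mult add: power_add)
    with \<open>z ^ a = 1\<close> z show False by simp
  qed
  moreover have "(z ^ a) ^ ?p = 1" using z by (metis mult.commute power_mult power_one)
  ultimately show ?thesis using root[of "z ^ a"] by (simp add: R hom_mult)
qed

section \<open>Gauss sums\<close>

lemma primitive_root_of_unityD:
  assumes "primitive_root_of_unity m z"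
  shows "z ^ m = 1" "m > 1 \<Longrightarrow> z \<noteq> 1"
  using assms by (auto simp: primitive_root_of_unity_def dest: spec[of _ 1])

text \<open>The representative is nonnegative, so a natural exponent can replace the
  \<open>powi\<close> of \<open>gauss_period\<close>.\<close>

definition add_char :: "complex \<Rightarrow> 'p::prime_card mod_ring \<Rightarrow> complex" where
  "add_char z x = z ^ nat (to_int_mod_ring x)"

lemma sum_mult_mod_ring:
  fixes a :: "'p::prime_card mod_ring"
  assumes "a \<noteq> 0"
  shows "(\<Sum>x\<in>UNIV. f (a * x)) = (\<Sum>x\<in>UNIV. f x)"
  by (rule sum.reindex_bij_witness[of _ "\<lambda>x. x / a" "\<lambda>x. a * x"]) (use assms in auto)

lemma sum_uminus_mod_ring:
  "(\<Sum>x\<in>UNIV. f (- x)) = (\<Sum>x\<in>(UNIV :: 'p::prime_card mod_ring set). f x)"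
  by (rule sum.reindex_bij_witness[of _ uminus uminus]) auto

lemma sum_add_mod_ring:
  fixes a :: "'p::prime_card mod_ring"
  shows "(\<Sum>x\<in>UNIV. f (a + x)) = (\<Sum>x\<in>UNIV. f x)"
  by (rule sum.reindex_bij_witness[of _ "\<lambda>x. x - a" "\<lambda>x. a + x"]) auto

context
  fixes z :: complex
  assumes z: "primitive_root_of_unity CARD('p::prime_card) z"
begin

text \<open>Every field element is the image of a natural number, so this reduces the homomorphism
  laws of \<open>add_char\<close> to the laws of powers.\<close>

lemma add_char_of_nat: "add_char z (of_nat m :: 'p mod_ring) = z ^ m"
proof -
  have "nat (to_int_mod_ring (of_nat m :: 'p mod_ring)) = m mod CARD('p)"
    by (simp add: of_nat_of_int_mod_ring of_int_mod_ring.rep_eq to_int_mod_ring.rep_eq nat_mod_as_int)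
  moreover have "z ^ m = (z ^ CARD('p)) ^ (m div CARD('p)) * z ^ (m mod CARD('p))"
    by (simp flip: power_mult power_add)
  ultimately show ?thesis
    using primitive_root_of_unityD(1)[OF z] by (simp add: add_char_def)
qed

lemma add_char_add: "add_char z (x + y :: 'p mod_ring) = add_char z x * add_char z y"
  by (metis add_char_of_nat of_nat_add power_add surj_of_nat_mod_ring)

lemma add_char_mult_of_nat: "add_char z (a * of_nat m :: 'p mod_ring) = add_char z a ^ m"
  by (metis add_char_of_nat of_nat_mult power_mult surj_of_nat_mod_ring)

lemma add_char_0: "add_char z (0 :: 'p mod_ring) = 1"
  using add_char_of_nat[of 0] by simp

lemma add_char_1: "add_char z (1 :: 'p mod_ring) = z"
  using add_char_of_nat[of 1] by simp

lemma cnj_add_char: "cnj (add_char z x) = add_char z (- x :: 'p mod_ring)"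
proof -
  have "norm z ^ CARD('p) = 1"
    using primitive_root_of_unityD(1)[OF z] by (metis norm_one norm_power)
  then have "norm z = 1"
    using power_eq_1_iff[of "norm z" "CARD('p)"] by simp
  then have "norm (add_char z x) = 1" by (simp add: add_char_def norm_power)
  then have "add_char z x * cnj (add_char z x) = 1"
    by (simp add: complex_norm_square [symmetric])
  moreover have "add_char z x * add_char z (- x) = 1"
    by (simp flip: add_char_add add: add_char_0)
  ultimately show ?thesis
    by (metis mult.left_commute mult.right_neutral)
qed

text \<open>Translating the summation variable by 1 multiplies the full sum by \<open>z\<close>,
  which is not 1.\<close>

lemma sum_add_char:
  fixes a :: "'p mod_ring"
  shows "(\<Sum>x\<in>UNIV. add_char z (a * x)) = (if a = 0 then of_nat CARD('p) else 0)"
proof (cases "a = 0")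
  case True
  then show ?thesis by (simp add: add_char_0)
next
  case False
  let ?S = "\<Sum>x\<in>(UNIV :: 'p mod_ring set). add_char z x"
  have "z * ?S = (\<Sum>x\<in>UNIV. add_char z (1 + x :: 'p mod_ring))"
    by (simp add: sum_distrib_left add_char_add add_char_1)
  also have "\<dots> = ?S" by (rule sum_add_mod_ring)
  finally have "(z - 1) * ?S = 0" by (simp add: algebra_simps)
  moreover have "z \<noteq> 1"
    using primitive_root_of_unityD(2)[OF z] prime_gt_1_nat[OF prime_card[where 'a = 'p]] by blast
  ultimately have "?S = 0" by simp
  with False show ?thesis by (simp add: sum_mult_mod_ring)
qed

end

section \<open>Multiplicative characters of the prime field\<close>

lemma mult_char_mult:
  assumes "mult_char A"
  shows "A (x * y) = A x * A y"
  using assms by (cases "x = 0 \<or> y = 0") (auto simp: mult_char_def)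

lemma mult_char_0: "mult_char A \<Longrightarrow> A 0 = 0"
  by (simp add: mult_char_def)

lemma mult_char_1:
  assumes "mult_char A"
  shows "A 1 = 1"
  using mult_char_mult[OF assms, of 1 1] assms by (simp add: mult_char_def)

lemma mult_char_power:
  assumes "mult_char A"
  shows "A (x ^ m) = A x ^ m"
  by (induction m) (simp_all add: mult_char_1[OF assms] mult_char_mult[OF assms])

lemma card_nonzero_mod_ring: "card (- {0 :: 'p::prime_card mod_ring}) = CARD('p) - 1"
  by (simp add: Compl_eq_Diff_UNIV card_Diff_singleton)

text \<open>Multiplication by \<open>x\<close> permutes the nonzero elements and so preserves their
  product.\<close>

lemma mod_ring_power_card:
  fixes x :: "'p::prime_card mod_ring"
  assumes "x \<noteq> 0"
  shows "x ^ (CARD('p) - 1) = 1"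
proof -
  have "(\<Prod>y\<in>-{0}. x * y) = (\<Prod>y\<in>-{0}. y :: 'p mod_ring)"
    by (rule prod.reindex_bij_witness[of _ "\<lambda>y. y / x" "\<lambda>y. x * y"]) (use assms in auto)
  then have "x ^ (CARD('p) - 1) * (\<Prod>y\<in>-{0}. y) = (\<Prod>y\<in>-{0}. y :: 'p mod_ring)"
    by (simp add: prod.distrib card_nonzero_mod_ring)
  moreover have "(\<Prod>y\<in>-{0}. y :: 'p mod_ring) \<noteq> 0" by simp
  ultimately show ?thesis by simp
qed

lemma norm_mult_char:
  fixes A :: "'p::prime_card mod_ring \<Rightarrow> complex"
  assumes "mult_char A" "x \<noteq> 0"
  shows "norm (A x) = 1"
proof -
  have "A x ^ (CARD('p) - 1) = 1"
    using assms by (metis mod_ring_power_card mult_char_1 mult_char_power)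
  then have "norm (A x) ^ (CARD('p) - 1) = 1" by (metis norm_one norm_power)
  moreover have "CARD('p) - 1 > 0"
    using prime_gt_1_nat[OF prime_card[where 'a = 'p]] by simp
  ultimately show ?thesis
    using power_eq_1_iff[of "norm (A x)" "CARD('p) - 1"] by auto
qed

lemma mult_char_cnj:
  assumes "mult_char A" "x \<noteq> 0"
  shows "A x * cnj (A x) = 1"
  using norm_mult_char[OF assms] by (simp add: complex_norm_square [symmetric])

lemma sum_mult_char_eq_0:
  assumes "mult_char A" "a \<noteq> 0" "A a \<noteq> 1"
  shows "(\<Sum>x\<in>UNIV. A x) = 0"
proof -
  have "A a * (\<Sum>x\<in>UNIV. A x) = (\<Sum>x\<in>UNIV. A (a * x))"
    using assms(1) by (simp add: sum_distrib_left mult_char_mult)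
  also have "\<dots> = (\<Sum>x\<in>UNIV. A x)" using assms(2) by (rule sum_mult_mod_ring)
  finally have "(A a - 1) * (\<Sum>x\<in>UNIV. A x) = 0" by (simp add: algebra_simps)
  with assms show ?thesis by simp
qed

section \<open>Products and absolute values of Gauss sums\<close>

definition gauss_sum :: "complex \<Rightarrow> ('p::prime_card mod_ring \<Rightarrow> complex) \<Rightarrow> complex" where
  "gauss_sum z A = (\<Sum>x\<in>UNIV. A x * add_char z x)"

text \<open>The double sum is sorted by \<open>s = x + y\<close>. For nonzero \<open>s\<close>,
  rescaling \<open>x\<close> by \<open>s\<close> extracts the Jacobi sum; the slice
  \<open>s = 0\<close> gives the second term.\<close>

lemma gauss_sum_mult:
  fixes A B :: "'p::prime_card mod_ring \<Rightarrow> complex"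
  assumes z: "primitive_root_of_unity CARD('p) z" and A: "mult_char A" and B: "mult_char B"
  shows "gauss_sum z A * gauss_sum z B =
    gauss_sum z (\<lambda>x. A x * B x) * jacobi_sum A B + B (-1) * (\<Sum>x\<in>UNIV. A x * B x)"
proof -
  have inner: "(\<Sum>x\<in>UNIV. A x * B (s - x)) = A s * B s * jacobi_sum A B +
      (if s = 0 then B (-1) * (\<Sum>x\<in>UNIV. A x * B x) else 0)" for s
  proof (cases "s = 0")
    case True
    have "(\<Sum>x\<in>UNIV. A x * B (- x)) = (\<Sum>x\<in>UNIV. B (-1) * (A x * B x))"
    proof (intro sum.cong refl)
      fix x show "A x * B (- x) = B (-1) * (A x * B x)"
        using mult_char_mult[OF B, of "-1" x] by simp
    qed
    then show ?thesis
      using True mult_char_0[OF A] by (simp add: sum_distrib_left)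
  next
    case False
    have "(\<Sum>x\<in>UNIV. A x * B (s - x)) = (\<Sum>x\<in>UNIV. A (s * x) * B (s - s * x))"
      using sum_mult_mod_ring[OF False, of "\<lambda>x. A x * B (s - x)"] by simp
    also have "\<dots> = (\<Sum>x\<in>UNIV. A s * B s * (A x * B (1 - x)))"
    proof (intro sum.cong refl)
      fix x
      have "s - s * x = s * (1 - x)" by (simp add: algebra_simps)
      then show "A (s * x) * B (s - s * x) = A s * B s * (A x * B (1 - x))"
        by (simp only: mult_char_mult[OF A] mult_char_mult[OF B] mult_ac)
    qed
    also have "\<dots> = A s * B s * jacobi_sum A B"
      by (simp add: jacobi_sum_def sum_distrib_left)
    finally show ?thesis using False by simp
  qed
  have "gauss_sum z A * gauss_sum z B =
      (\<Sum>x\<in>UNIV. \<Sum>y\<in>UNIV. A x * B y * add_char z (x + y))"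
    by (simp add: gauss_sum_def sum_product add_char_add[OF z] mult_ac)
  also have "\<dots> = (\<Sum>x\<in>UNIV. \<Sum>s\<in>UNIV. A x * B (s - x) * add_char z s)"
  proof (rule sum.cong[OF refl])
    fix x
    show "(\<Sum>y\<in>UNIV. A x * B y * add_char z (x + y)) = (\<Sum>s\<in>UNIV. A x * B (s - x) * add_char z s)"
      using sum_add_mod_ring[of "\<lambda>s. A x * B (s - x) * add_char z s" x] by simp
  qed
  also have "\<dots> = (\<Sum>s\<in>UNIV. (\<Sum>x\<in>UNIV. A x * B (s - x)) * add_char z s)"
    by (subst sum.swap) (simp add: sum_distrib_right)
  also have "\<dots> = (\<Sum>s\<in>UNIV. A s * B s * add_char z s * jacobi_sum A B +
      (if s = 0 then B (-1) * (\<Sum>x\<in>UNIV. A x * B x) else 0))"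
    unfolding inner by (intro sum.cong refl) (simp add: algebra_simps add_char_0[OF z])
  also have "\<dots> = gauss_sum z (\<lambda>x. A x * B x) * jacobi_sum A B + B (-1) * (\<Sum>x\<in>UNIV. A x * B x)"
    unfolding sum.distrib by (simp add: gauss_sum_def sum_distrib_right)
  finally show ?thesis .
qed

text \<open>Replacing \<open>x\<close> by \<open>y * x\<close> cancels the values at
  \<open>y\<close>. Summing over nonzero \<open>y\<close> then leaves \<open>p\<close> from
  \<open>x = 1\<close>, minus the sum of \<open>A\<close>, which vanishes by assumption.\<close>

lemma gauss_sum_norm:
  fixes A :: "'p::prime_card mod_ring \<Rightarrow> complex"
  assumes z: "primitive_root_of_unity CARD('p) z" and A: "mult_char A" and "(\<Sum>x\<in>UNIV. A x) = 0"
  shows "gauss_sum z A * cnj (gauss_sum z A) = of_nat CARD('p)"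
proof -
  have "gauss_sum z A * cnj (gauss_sum z A) =
      (\<Sum>y\<in>UNIV. \<Sum>x\<in>UNIV. A x * cnj (A y) * add_char z (x - y))"
    by (subst sum.swap)
      (simp add: gauss_sum_def sum_product cnj_add_char[OF z] mult_ac flip: add_char_add[OF z])
  also have "\<dots> = (\<Sum>y\<in>-{0}. \<Sum>x\<in>UNIV. A x * cnj (A y) * add_char z (x - y))"
    by (intro sum.mono_neutral_right) (auto simp: mult_char_0[OF A])
  also have "\<dots> = (\<Sum>y\<in>-{0}. \<Sum>x\<in>UNIV. A x * add_char z ((x - 1) * y))"
  proof (rule sum.cong[OF refl])
    fix y :: "'p mod_ring" assume "y \<in> -{0}"
    then have y: "y \<noteq> 0" by simp
    have "(\<Sum>x\<in>UNIV. A x * cnj (A y) * add_char z (x - y)) =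
        (\<Sum>x\<in>UNIV. A (y * x) * cnj (A y) * add_char z (y * x - y))"
      using sum_mult_mod_ring[OF y, of "\<lambda>x. A x * cnj (A y) * add_char z (x - y)"] by simp
    also have "\<dots> = (\<Sum>x\<in>UNIV. A x * add_char z ((x - 1) * y))"
    proof (intro sum.cong refl)
      fix x
      have "A (y * x) * cnj (A y) = A x"
        using mult_char_cnj[OF A y] by (simp add: mult_char_mult[OF A] mult_ac)
      moreover have "y * x - y = (x - 1) * y" by (simp add: algebra_simps)
      ultimately show "A (y * x) * cnj (A y) * add_char z (y * x - y) = A x * add_char z ((x - 1) * y)"
        by simp
    qed
    finally show "(\<Sum>x\<in>UNIV. A x * cnj (A y) * add_char z (x - y)) =
        (\<Sum>x\<in>UNIV. A x * add_char z ((x - 1) * y))" .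
  qed
  also have "\<dots> = (\<Sum>x\<in>UNIV. A x * (\<Sum>y\<in>-{0}. add_char z ((x - 1) * y)))"
    by (subst sum.swap) (simp add: sum_distrib_left)
  also have "\<dots> = (\<Sum>x\<in>UNIV. (if x = 1 then of_nat CARD('p) else 0) - A x)"
  proof (intro sum.cong refl)
    fix x :: "'p mod_ring"
    have "(\<Sum>y\<in>-{0}. add_char z ((x - 1) * y)) = (if x = 1 then of_nat CARD('p) else 0) - 1"
      using sum_add_char[OF z, of "x - 1"]
      by (simp add: Compl_eq_Diff_UNIV sum_diff1 add_char_0[OF z])
    then show "A x * (\<Sum>y\<in>-{0}. add_char z ((x - 1) * y)) =
        (if x = 1 then of_nat CARD('p) else 0) - A x"
      by (simp add: mult_char_1[OF A] right_diff_distrib)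
  qed
  also have "\<dots> = of_nat CARD('p)"
    unfolding sum_subtractf assms(3) by simp
  finally show ?thesis .
qed

section \<open>Jacobi sums of the powers of a character\<close>

text \<open>Abstracts from \<open>chi\<close>: \<open>psi\<close> will be its \<open>k\<close>-th
  power. The range hypothesis says that the order is exactly \<open>n\<close> and makes every fibre
  nonempty.\<close>

locale power_residue_char =
  fixes psi :: "'p::prime_card mod_ring \<Rightarrow> complex" and n :: nat and z :: complex
  assumes z: "primitive_root_of_unity CARD('p) z"
    and psi: "mult_char psi"
    and range_psi: "psi ` (- {0}) = {w. w ^ n = 1}"
    and n_gt_1: "n > 1"
begin

definition om :: complex where "om = cis (2 * pi / of_nat n)"

text \<open>The powers of \<open>psi\<close> in the character group: \<open>pw 0\<close> vanishes at 0, unlike \<open>\<lambda>x. psi x ^ 0\<close>.\<close>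

definition pw :: "nat \<Rightarrow> 'p mod_ring \<Rightarrow> complex" where
  "pw i x = (if x = 0 then 0 else psi x ^ i)"

definition gs :: "nat \<Rightarrow> complex" where "gs i = gauss_sum z (pw i)"

text \<open>The index counts modulo \<open>n\<close> only, so sums of indices need no reduction.
  \<open>fibre 0\<close> is the kernel of \<open>psi\<close>.\<close>

definition fibre :: "nat \<Rightarrow> 'p mod_ring set" where "fibre t = {x. psi x = om ^ t}"

definition period :: "nat \<Rightarrow> complex" where
  "period t = (\<Sum>x\<in>fibre t. add_char z x)"

lemma om_power: "om ^ t = cis (2 * pi * real t / real n)"
  by (simp add: om_def DeMoivre mult_ac)

lemma om_power_n: "om ^ n = 1"
  using n_gt_1 by (simp add: om_power)

lemma om_nonzero: "om \<noteq> 0"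
  using om_power_n n_gt_1 by (auto simp: power_0_left)

lemma bij_betw_om: "bij_betw (\<lambda>t. om ^ t) {..<n} {w. w ^ n = 1}"
  unfolding om_power using n_gt_1 by (intro bij_betw_roots_unity) simp

lemma om_power_inj: "i < n \<Longrightarrow> j < n \<Longrightarrow> om ^ i = om ^ j \<longleftrightarrow> i = j"
  using bij_betw_om by (auto simp: bij_betw_def inj_on_def)

lemma om_power_mod: "om ^ (i mod n) = om ^ i"
proof -
  have "om ^ i = (om ^ n) ^ (i div n) * om ^ (i mod n)"
    by (simp flip: power_mult power_add)
  then show ?thesis by (simp add: om_power_n)
qed

lemma om_power_eq_1: "om ^ i = 1 \<longleftrightarrow> n dvd i"
  using om_power_inj[of "i mod n" 0] n_gt_1 by (simp add: om_power_mod dvd_eq_mod_eq_0)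

lemma psi_power_n: "x \<noteq> 0 \<Longrightarrow> psi x ^ n = 1"
  using range_psi by auto

lemma psi_index:
  assumes "x \<noteq> 0"
  obtains s where "s < n" "psi x = om ^ s" "\<And>t. t < n \<Longrightarrow> psi x = om ^ t \<longleftrightarrow> t = s"
proof -
  have "psi x \<in> (\<lambda>t. om ^ t) ` {..<n}"
    using bij_betw_om psi_power_n[OF assms] by (simp add: bij_betw_def)
  then obtain s where "s < n" "psi x = om ^ s" by auto
  with that[of s] show ?thesis using om_power_inj by auto
qed

lemma fibre_nonempty: obtains a where "a \<noteq> 0" "psi a = om ^ t"
proof -
  have "om ^ t \<in> {w. w ^ n = 1}" by (simp add: om_power_n flip: power_mult add: mult.commute[of t] power_mult)
  then show ?thesis using range_psi that by (metis (no_types, lifting) ComplD imageE singletonI)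
qed

lemma fibre_nonzero: "x \<in> fibre t \<Longrightarrow> x \<noteq> 0"
  using om_nonzero mult_char_0[OF psi] by (auto simp: fibre_def)

lemma sum_index:
  "(\<Sum>t<n. if x \<in> fibre t then om ^ (m * t) else 0) = pw m x"
proof (cases "x = 0")
  case True
  moreover have "0 \<notin> fibre t" for t using fibre_nonzero by blast
  ultimately show ?thesis by (simp add: pw_def)
next
  case False
  obtain s where s: "s < n" "psi x = om ^ s" "\<And>t. t < n \<Longrightarrow> psi x = om ^ t \<longleftrightarrow> t = s"
    using psi_index[OF False] by metis
  have "(\<Sum>t<n. if x \<in> fibre t then om ^ (m * t) else 0) = (\<Sum>t<n. if t = s then om ^ (m * t) else 0)"
    by (intro sum.cong refl) (simp add: fibre_def s(3))
  also have "\<dots> = om ^ (m * s)" using s(1) by simp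
  also have "\<dots> = pw m x" using False s(2) by (simp add: pw_def mult.commute flip: power_mult)
  finally show ?thesis .
qed

text \<open>The fibres with index below \<open>n\<close> partition the nonzero elements, and
  \<open>pw m\<close> is constant on each. Passages between periods and character sums go through
  this identity.\<close>

lemma sum_fibres:
  "(\<Sum>t<n. om ^ (m * t) * (\<Sum>x\<in>fibre t. f x)) = (\<Sum>x\<in>UNIV. pw m x * f x)"
proof -
  have "(\<Sum>t<n. om ^ (m * t) * (\<Sum>x\<in>fibre t. f x)) =
      (\<Sum>t<n. \<Sum>x\<in>UNIV. (if x \<in> fibre t then om ^ (m * t) else 0) * f x)"
  proof (rule sum.cong[OF refl])
    fix t
    show "om ^ (m * t) * (\<Sum>x\<in>fibre t. f x) =
        (\<Sum>x\<in>UNIV. (if x \<in> fibre t then om ^ (m * t) else 0) * f x)"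
      unfolding sum_distrib_left by (rule sum.mono_neutral_cong_left) auto
  qed
  also have "\<dots> = (\<Sum>x\<in>UNIV. pw m x * f x)"
    by (subst sum.swap) (simp add: sum_index flip: sum_distrib_right)
  finally show ?thesis .
qed

lemma gs_periods: "gs m = (\<Sum>t<n. om ^ (m * t) * period t)"
  unfolding period_def sum_fibres by (simp add: gs_def gauss_sum_def)

lemma mult_char_pw: "mult_char (pw i)"
  using psi by (auto simp: mult_char_def pw_def power_mult_distrib)

lemma pw_mult: "(\<lambda>x. pw i x * pw j x) = pw (i + j)"
  by (auto simp: pw_def power_add)

lemma psi_power_dvd: "x \<noteq> 0 \<Longrightarrow> n dvd m \<Longrightarrow> psi x ^ m = 1"
  by (auto simp: psi_power_n power_mult elim!: dvdE)

lemma pw_dvd: "n dvd m \<Longrightarrow> pw m x = (if x = 0 then 0 else 1)"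
  by (simp add: pw_def psi_power_dvd)

lemma sum_pw: "(\<Sum>x\<in>UNIV. pw m x) = (if n dvd m then of_nat CARD('p) - 1 else 0)"
proof (cases "n dvd m")
  case True
  have "(\<Sum>x\<in>UNIV. pw m x) = (\<Sum>x\<in>(UNIV :: 'p mod_ring set). 1 - (if x = 0 then 1 else 0))"
    by (intro sum.cong refl) (simp add: pw_dvd[OF True])
  also have "\<dots> = of_nat CARD('p) - 1" unfolding sum_subtractf by simp
  finally show ?thesis using True by simp
next
  case False
  obtain a where a: "a \<noteq> 0" "psi a = om ^ 1" by (rule fibre_nonempty)
  then have "pw m a \<noteq> 1" using False om_power_eq_1[of m] by (simp add: pw_def)
  then show ?thesis using False sum_mult_char_eq_0[OF mult_char_pw a(1)] by simp
qed

text \<open>The trivial character omits \<open>x = 0\<close>, whose term is 1, from a full additive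
  sum that is 0.\<close>

lemma gs_dvd:
  assumes "n dvd m"
  shows "gs m = -1"
proof -
  have "gs m = (\<Sum>x\<in>UNIV. add_char z x - (if x = (0 :: 'p mod_ring) then 1 else 0))"
    unfolding gs_def gauss_sum_def
    by (intro sum.cong refl) (simp add: pw_dvd[OF assms] add_char_0[OF z])
  also have "\<dots> = -1"
    unfolding sum_subtractf using sum_add_char[OF z, of 1] by simp
  finally show ?thesis .
qed

lemma gs_norm: "\<not> n dvd m \<Longrightarrow> gs m * cnj (gs m) = of_nat CARD('p)"
  unfolding gs_def by (rule gauss_sum_norm[OF z mult_char_pw]) (simp add: sum_pw)

lemma psi_minus_1: "psi (-1) = 1 \<or> psi (-1) = -1"
  using mult_char_mult[OF psi, of "-1" "-1"] mult_char_1[OF psi]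
  by (metis mult_minus1_right minus_minus square_eq_1_iff)

lemma psi_minus_1_power: "psi (-1) ^ j * psi (-1) ^ j = 1"
  using psi_minus_1 by (auto simp flip: power_mult_distrib)

text \<open>Conjugation inverts \<open>psi ^ j\<close>, giving \<open>psi ^ i\<close>, and negates
  the additive argument; substituting \<open>- x\<close> produces the factor
  \<open>psi (-1) ^ j\<close>.\<close>

lemma cnj_gs:
  assumes "n dvd i + j"
  shows "cnj (gs j) = psi (-1) ^ j * gs i"
proof -
  have "cnj (gs j) = (\<Sum>x\<in>UNIV. cnj (pw j x) * add_char z (- x))"
    by (simp add: gs_def gauss_sum_def cnj_add_char[OF z])
  also have "\<dots> = (\<Sum>x\<in>UNIV. cnj (pw j (- x)) * add_char z x)"
    using sum_uminus_mod_ring[of "\<lambda>x. cnj (pw j x) * add_char z (- x)"] by simp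
  also have "\<dots> = (\<Sum>x\<in>UNIV. psi (-1) ^ j * (pw i x * add_char z x))"
  proof (rule sum.cong[OF refl])
    fix x :: "'p mod_ring"
    have "cnj (pw j (- x)) = psi (-1) ^ j * pw i x"
    proof (cases "x = 0")
      case False
      have "psi (- x) = psi (-1) * psi x"
        using mult_char_mult[OF psi, of "-1" x] by simp
      moreover have "cnj (psi (-1)) = psi (-1)" using psi_minus_1 by auto
      moreover have "cnj (psi x) ^ j = psi x ^ i"
      proof -
        have "psi x ^ i = psi x ^ i * (psi x * cnj (psi x)) ^ j"
          using mult_char_cnj[OF psi False] by simp
        also have "\<dots> = psi x ^ (i + j) * cnj (psi x) ^ j"
          by (simp add: power_mult_distrib power_add mult_ac)
        finally show ?thesis using psi_power_dvd[OF False assms] by simp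
      qed
      ultimately show ?thesis using False by (simp add: pw_def power_mult_distrib)
    qed (simp add: pw_def)
    then show "cnj (pw j (- x)) * add_char z x = psi (-1) ^ j * (pw i x * add_char z x)"
      by simp
  qed
  also have "\<dots> = psi (-1) ^ j * gs i"
    by (simp add: gs_def gauss_sum_def sum_distrib_left)
  finally show ?thesis .
qed

lemma gs_mult_dvd:
  assumes "n dvd i + j" "\<not> n dvd j"
  shows "gs i * gs j = psi (-1) ^ j * of_nat CARD('p)"
proof -
  have "gs i = psi (-1) ^ j * cnj (gs j)"
    using cnj_gs[OF assms(1)] psi_minus_1_power[of j] by (simp flip: mult.assoc)
  then show ?thesis using gs_norm[OF assms(2)] by (simp add: mult_ac)
qed

text \<open>If \<open>n\<close> does not divide \<open>i + j\<close>, multiply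
  \<open>gauss_sum_mult\<close> by the conjugate of \<open>gs (i + j)\<close>. Otherwise
  \<open>gs (i + j) = -1\<close>. At \<open>i = j = 0\<close> the Jacobi sum is p - 2 but the
  product formula gives -1/p, whence the correction.\<close>

lemma jacobi_sum_pw:
  assumes "i < n" "j < n"
  shows "jacobi_sum (pw i) (pw j) = gs i * gs j * cnj (gs (i + j)) / of_nat CARD('p) +
    (if i = 0 \<and> j = 0 then (of_nat CARD('p) - 1) ^ 2 / of_nat CARD('p) else 0)"
proof -
  let ?J = "jacobi_sum (pw i) (pw j)"
  have p0: "of_nat CARD('p) \<noteq> (0 :: complex)" by simp
  have prod: "gs i * gs j = gs (i + j) * ?J + pw j (-1) * (if n dvd i + j then of_nat CARD('p) - 1 else 0)"
    using gauss_sum_mult[OF z mult_char_pw mult_char_pw, of i j] unfolding pw_mult sum_pw gs_def .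
  have "n dvd i \<longleftrightarrow> i = 0" using assms by (auto dest: dvd_imp_le)
  then consider "\<not> n dvd i + j" | "i = 0" "j = 0" | "n dvd i + j" "j \<noteq> 0"
    by (cases "j = 0") auto
  then show ?thesis
  proof cases
    case 1
    then have "gs i * gs j * cnj (gs (i + j)) = of_nat CARD('p) * ?J"
      using prod gs_norm[OF 1] by (simp add: mult_ac)
    then show ?thesis using 1 p0 by auto
  next
    case 2
    then show ?thesis using prod gs_dvd[of 0] p0
      by (simp add: pw_def field_simps power2_eq_square)
  next
    case 3
    then have "\<not> n dvd j" using assms by (auto dest: dvd_imp_le)
    then have "gs i * gs j = psi (-1) ^ j * of_nat CARD('p)" by (rule gs_mult_dvd[OF 3(1)])
    moreover have "gs (i + j) = -1" using gs_dvd 3 by blast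
    moreover from calculation have "psi (-1) ^ j * of_nat CARD('p) = - ?J + psi (-1) ^ j * (of_nat CARD('p) - 1)"
      using prod 3 by (simp add: pw_def)
    then have "psi (-1) ^ j + ?J = 0"
      by (simp add: algebra_simps)
    then have "?J = - (psi (-1) ^ j)"
      by (rule minus_unique [symmetric])
    ultimately show ?thesis using 3 p0 by simp
  qed
qed

lemma sum_cnj_om: "(\<Sum>t<n. cnj om ^ (m * t)) = (if n dvd m then of_nat n else 0)"
proof (cases "n dvd m")
  case True
  then have "cnj om ^ m = 1" using om_power_eq_1[of m] by (metis complex_cnj_one complex_cnj_power)
  then show ?thesis using True by (simp add: power_mult)
next
  case False
  have "om ^ m \<noteq> 1" using om_power_eq_1 False by simp
  then have ne: "cnj om ^ m \<noteq> 1" by (metis complex_cnj_cnj complex_cnj_one complex_cnj_power)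
  have "(cnj om ^ m) ^ n = 1"
    using om_power_n by (metis complex_cnj_one complex_cnj_power mult.commute power_mult power_one)
  then have "(cnj om ^ m - 1) * (\<Sum>t<n. (cnj om ^ m) ^ t) = 0"
    by (metis diff_self power_diff_1_eq)
  then show ?thesis using False ne by (simp add: power_mult)
qed

text \<open>\<open>?V\<close> times its transpose is supported where \<open>n\<close> divides
  \<open>i + j\<close>, by orthogonality. The square suffices because \<open>?V\<close> enters the
  factorization of the Jacobi matrix twice.\<close>

lemma det_gauss_mat:
  "Determinant.det (mat n n (\<lambda>(i, t). gs i * cnj om ^ (i * t))) ^ 2 =
    (-1) ^ ((n - 1) * (n - 2) div 2) * of_nat n ^ n * of_nat CARD('p) ^ (n - 1) * psi (-1) ^ (n * (n - 1) div 2)"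
  (is "Determinant.det ?V ^ 2 = _")
proof -
  \<comment> \<open>Column 0 is exceptional: its only supported entry carries \<open>gs 0\<close>
    squared, which is 1 and not \<open>p\<close>.\<close>
  let ?c = "\<lambda>j. of_nat n * (if j = 0 then 1 else of_nat CARD('p)) * psi (-1) ^ j"
  have "?V * transpose_mat ?V = mat n n (\<lambda>(i, j). if n dvd i + j then ?c j else 0)"
  proof (rule eq_matI)
    fix i j assume "i < dim_row (mat n n (\<lambda>(i, j). if n dvd i + j then ?c j else 0))"
      "j < dim_col (mat n n (\<lambda>(i, j). if n dvd i + j then ?c j else 0))"
    then have ij: "i < n" "j < n" by auto
    then have "(?V * transpose_mat ?V) $$ (i, j) = (\<Sum>t<n. gs i * gs j * cnj om ^ ((i + j) * t))"
      by (simp add: scalar_prod_def lessThan_atLeast0 algebra_simps power_add)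
    also have "\<dots> = gs i * gs j * (if n dvd i + j then of_nat n else 0)"
      by (simp only: sum_distrib_left [symmetric] sum_cnj_om)
    also have "\<dots> = (if n dvd i + j then ?c j else 0)"
    proof (cases "j = 0")
      case True
      then show ?thesis using ij gs_dvd[of 0] by (auto dest: dvd_imp_le)
    next
      case False
      then have "\<not> n dvd j" using ij by (auto dest: dvd_imp_le)
      then show ?thesis using gs_mult_dvd[of i j] False by simp
    qed
    finally show "(?V * transpose_mat ?V) $$ (i, j) =
        mat n n (\<lambda>(i, j). if n dvd i + j then ?c j else 0) $$ (i, j)"
      using ij by simp
  qed auto
  then have "Determinant.det ?V ^ 2 = Determinant.det (mat n n (\<lambda>(i, j). if n dvd i + j then ?c j else 0))"
    using det_mult[of ?V n "transpose_mat ?V"] det_transpose[of ?V n] by (simp add: power2_eq_square)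
  also have "\<dots> = (-1) ^ ((n - 1) * (n - 2) div 2) * (\<Prod>j<n. ?c j)"
    using n_gt_1 by (intro det_index_sum_dvd) simp
  also have "(\<Prod>j<n. ?c j) = of_nat n ^ n * of_nat CARD('p) ^ (n - 1) * psi (-1) ^ (n * (n - 1) div 2)"
  proof -
    obtain m where m: "n = Suc m" using n_gt_1 by (cases n) auto
    have "(\<Prod>j<n. (if j = 0 then 1 else of_nat CARD('p)) :: complex) = of_nat CARD('p) ^ (n - 1)"
      by (simp add: m prod.lessThan_Suc_shift del: prod.lessThan_Suc)
    moreover have "(\<Prod>j<n. psi (-1) ^ j) = psi (-1) ^ (n * (n - 1) div 2)"
      by (simp add: Sum_Ico_nat lessThan_atLeast0 flip: power_sum)
    ultimately show ?thesis by (simp add: prod.distrib)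
  qed
  finally show ?thesis by (simp add: mult_ac)
qed

lemma det_jacobi_mat:
  "Determinant.det (mat n n (\<lambda>(i, j). gs i * gs j * cnj (gs (i + j)) / of_nat CARD('p) +
      (if i = 0 \<and> j = 0 then s else 0))) =
    (-1) ^ ((n - 1) * (n - 2) div 2) * of_nat n ^ n * of_nat CARD('p) ^ (n - 1) * psi (-1) ^ (n * (n - 1) div 2) *
    ((\<Prod>t<n. cnj (period t) / of_nat CARD('p)) +
      s / of_nat n ^ 2 * (\<Sum>t<n. \<Prod>u\<in>{..<n} - {t}. cnj (period u) / of_nat CARD('p)))"
  (is "Determinant.det ?Y = _")
proof -
  let ?V = "mat n n (\<lambda>(i, t). gs i * cnj om ^ (i * t))"
  let ?d = "\<lambda>t. cnj (period t) / of_nat CARD('p)"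
  let ?M = "mat n n (\<lambda>(t, u). (if t = u then ?d t else 0) + s / of_nat n ^ 2)"
  \<comment> \<open>Row sums of \<open>?V\<close>. Only row 0 has a nonzero one, \<open>- n\<close>,
    so the constant part of \<open>?M\<close> contributes exactly \<open>s\<close> in the corner and
    nothing elsewhere.\<close>
  define R where "R i = (\<Sum>t<n. gs i * cnj om ^ (i * t))" for i
  have row: "R i = (if i = 0 then - of_nat n else 0)" if "i < n" for i
    unfolding R_def using that gs_dvd[of 0] by (auto simp: sum_cnj_om simp flip: sum_distrib_left dest: dvd_imp_le)
  have "?Y = ?V * ?M * transpose_mat ?V"
  proof (rule eq_matI)
    fix i j assume "i < dim_row (?V * ?M * transpose_mat ?V)" "j < dim_col (?V * ?M * transpose_mat ?V)"
    then have ij: "i < n" "j < n" by auto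
    then have "(?V * ?M * transpose_mat ?V) $$ (i, j) =
        (\<Sum>u<n. (\<Sum>t<n. gs i * cnj om ^ (i * t) * ((if t = u then ?d t else 0) + s / of_nat n ^ 2)) *
          (gs j * cnj om ^ (j * u)))"
      by (simp add: scalar_prod_def lessThan_atLeast0)
    also have "\<dots> = (\<Sum>u<n. (gs i * cnj om ^ (i * u) * ?d u +
        s / of_nat n ^ 2 * R i) * (gs j * cnj om ^ (j * u)))"
    proof (rule sum.cong[OF refl])
      fix u assume "u \<in> {..<n}"
      have "(\<Sum>t<n. gs i * cnj om ^ (i * t) * ((if t = u then ?d t else 0) + s / of_nat n ^ 2)) =
          (\<Sum>t<n. (if t = u then gs i * cnj om ^ (i * t) * ?d t else 0) +
            s / of_nat n ^ 2 * (gs i * cnj om ^ (i * t)))"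
        by (intro sum.cong refl) (auto simp: algebra_simps)
      also have "\<dots> = gs i * cnj om ^ (i * u) * ?d u + s / of_nat n ^ 2 * R i"
        unfolding sum.distrib sum_distrib_left [symmetric] R_def using \<open>u \<in> {..<n}\<close> by simp
      finally show "(\<Sum>t<n. gs i * cnj om ^ (i * t) * ((if t = u then ?d t else 0) + s / of_nat n ^ 2)) *
          (gs j * cnj om ^ (j * u)) = (gs i * cnj om ^ (i * u) * ?d u +
        s / of_nat n ^ 2 * R i) * (gs j * cnj om ^ (j * u))" by simp
    qed
    also have "\<dots> = gs i * gs j * (\<Sum>u<n. cnj om ^ ((i + j) * u) * cnj (period u)) / of_nat CARD('p) +
        s / of_nat n ^ 2 * R i * R j"
      by (simp only: distrib_right sum.distrib)
        (simp add: R_def[of j] sum_distrib_left sum_distrib_right sum_divide_distrib algebra_simps power_add)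
    also have "(\<Sum>u<n. cnj om ^ ((i + j) * u) * cnj (period u)) = cnj (gs (i + j))"
      by (simp add: gs_periods)
    also have "s / of_nat n ^ 2 * R i * R j =
        (if i = 0 \<and> j = 0 then s else 0)"
      unfolding row[OF ij(1)] row[OF ij(2)] using n_gt_1 by (simp add: power2_eq_square)
    finally show "?Y $$ (i, j) = (?V * ?M * transpose_mat ?V) $$ (i, j)"
      using ij by simp
  qed auto
  then have "Determinant.det ?Y = Determinant.det ?V ^ 2 * Determinant.det ?M"
    using det_mult[of "?V * ?M" n "transpose_mat ?V"] det_mult[of ?V n ?M] det_transpose[of ?V n]
      mult_carrier_mat[of ?V n n ?M n]
    by (simp add: power2_eq_square[of "Determinant.det ?V"])
  then show ?thesis
    unfolding det_gauss_mat det_diag_plus_const .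
qed

end

section \<open>The minimal polynomial of the Gaussian periods\<close>

text \<open>The difference of the two monic polynomials has degree below \<open>n\<close> but
  \<open>n\<close> distinct roots.\<close>

lemma monic_eq_prod_linear:
  fixes C :: "'a::field poly"
  assumes "lead_coeff C = 1" "degree C = n"
    and root: "\<And>i. i < n \<Longrightarrow> poly C (r i) = 0" and inj: "inj_on r {..<n}"
  shows "C = (\<Prod>i<n. [:- r i, 1:])"
proof (rule ccontr)
  let ?P = "\<Prod>i<n. [:- r i, 1:]"
  assume "C \<noteq> ?P"
  then have nz: "C - ?P \<noteq> 0" by simp
  have deg: "degree ?P = n" by (subst degree_prod_eq_sum_degree) auto
  have "Polynomial.coeff ?P n = 1"
    using lead_coeff_prod[of "\<lambda>i. [:- r i, 1:]" "{..<n}"] deg by simp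
  then have "Polynomial.coeff (C - ?P) n = 0" using assms(1,2) by simp
  moreover have "degree (C - ?P) \<le> n" using deg assms(2) by (metis degree_diff_le order_refl)
  ultimately have less: "degree (C - ?P) < n"
    using nz by (metis leading_coeff_0_iff order_le_less)
  have "r ` {..<n} \<subseteq> {x. poly (C - ?P) x = 0}"
    using root by (auto simp: poly_prod)
  then have "card (r ` {..<n}) \<le> card {x. poly (C - ?P) x = 0}"
    by (rule card_mono[OF poly_roots_finite[OF nz]])
  also have "\<dots> \<le> degree (C - ?P)" by (rule card_poly_roots_bound[OF nz])
  finally show False using less by (simp add: card_image[OF inj])
qed

text \<open>The coefficients are the values at 0 of the product and of its derivative.\<close>

lemma coeff_prod_linear:
  fixes r :: "nat \<Rightarrow> 'a::{idom, ring_char_0}"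
  shows "Polynomial.coeff (\<Prod>i<n. [:- r i, 1:]) 0 = (-1) ^ n * (\<Prod>i<n. r i)"
    and "Polynomial.coeff (\<Prod>i<n. [:- r i, 1:]) 1 = (-1) ^ (n - 1) * (\<Sum>i<n. \<Prod>j\<in>{..<n} - {i}. r j)"
proof -
  show "Polynomial.coeff (\<Prod>i<n. [:- r i, 1:]) 0 = (-1) ^ n * (\<Prod>i<n. r i)"
    unfolding poly_0_coeff_0 [symmetric] poly_prod by (simp add: prod_uminus)
  have "Polynomial.coeff (\<Prod>i<n. [:- r i, 1:]) 1 = poly (pderiv (\<Prod>i<n. [:- r i, 1:])) 0"
    unfolding poly_0_coeff_0 by (simp add: coeff_pderiv)
  also have "\<dots> = (\<Sum>i<n. \<Prod>j\<in>{..<n} - {i}. - r j)"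
    by (simp add: pderiv_prod poly_sum poly_prod pderiv_pCons)
  also have "\<dots> = (\<Sum>i<n. (-1) ^ (n - 1) * (\<Prod>j\<in>{..<n} - {i}. r j))"
    by (intro sum.cong refl) (simp add: prod_uminus)
  finally show "Polynomial.coeff (\<Prod>i<n. [:- r i, 1:]) 1 =
      (-1) ^ (n - 1) * (\<Sum>i<n. \<Prod>j\<in>{..<n} - {i}. r j)"
    by (simp add: sum_distrib_left)
qed

section \<open>Multiplication and conjugation of Gaussian periods\<close>

context power_residue_char
begin

lemma sum_fibre_mult:
  assumes a: "psi a = om ^ s"
  shows "(\<Sum>x\<in>fibre t. f (a * x)) = (\<Sum>x\<in>fibre (s + t). f x)"
proof (rule sum.reindex_bij_witness[of _ "\<lambda>x. x / a" "\<lambda>x. a * x"])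
  have "a \<noteq> 0" using a om_nonzero mult_char_0[OF psi] by auto
  then show "x / a \<in> fibre t" if "x \<in> fibre (s + t)" for x
    using that a mult_char_mult[OF psi, of a "x / a"] om_nonzero by (simp add: fibre_def power_add)
  show "a * x \<in> fibre (s + t)" if "x \<in> fibre t" for x
    using that a by (simp add: fibre_def power_add mult_char_mult[OF psi])
qed (use a om_nonzero mult_char_0[OF psi] in auto)

lemma period_shift:
  assumes "psi a = om ^ s"
  shows "period (s + t) = (\<Sum>x\<in>fibre t. add_char z (a * x))"
  unfolding period_def using sum_fibre_mult[OF assms, of "add_char z" t] by simp

lemma sum_period: "(\<Sum>t<n. period (s + t)) = -1"
proof -
  obtain a where a: "a \<noteq> 0" "psi a = om ^ s" by (rule fibre_nonempty)
  have "(\<Sum>t<n. period (s + t)) = (\<Sum>t<n. om ^ (0 * t) * (\<Sum>x\<in>fibre t. add_char z (a * x)))"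
    by (simp add: period_shift[OF a(2)])
  also have "\<dots> = (\<Sum>x\<in>UNIV. pw 0 x * add_char z (a * x))"
    by (rule sum_fibres)
  also have "\<dots> = (\<Sum>x\<in>UNIV. add_char z (a * x) - (if x = 0 then 1 else 0))"
    by (intro sum.cong refl) (simp add: pw_def add_char_0[OF z])
  also have "\<dots> = -1" unfolding sum_subtractf using sum_add_char[OF z, of a] a by simp
  finally show ?thesis .
qed

text \<open>
  The coefficients of \<open>\<eta>\<^sub>s \<eta>\<^sub>s\<^sub>+\<^sub>t\<close> in terms of the \<open>\<eta>\<^sub>s\<^sub>+\<^sub>r\<close>. The second term comes from the summands with
  \<open>1 + y = 0\<close>, whose constant contribution is spread over all periods by \<open>1 = - (\<Sum>r<n. \<eta>\<^sub>s\<^sub>+\<^sub>r)\<close>.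
\<close>

definition structure_const :: "nat \<Rightarrow> nat \<Rightarrow> int" where
  "structure_const t r = int (card {y \<in> fibre t. 1 + y \<in> fibre r}) -
     (if -1 \<in> fibre t then int (card (fibre 0)) else 0)"

text \<open>Writing the second summation variable as \<open>u * y\<close> with \<open>u\<close> in
  the kernel turns the exponent into \<open>a * u * (1 + y)\<close>. For fixed \<open>y\<close> the
  sum over \<open>u\<close> is the period of the class of \<open>1 + y\<close>, or a constant if
  \<open>y = -1\<close>.\<close>

lemma period_mult:
  "period s * period (s + t) = (\<Sum>r<n. of_int (structure_const t r) * period (s + r))"
proof -
  obtain a where a: "a \<noteq> 0" "psi a = om ^ s" by (rule fibre_nonempty)
  let ?N = "\<lambda>r. {y \<in> fibre t. 1 + y \<in> fibre r}"
  let ?k = "of_nat (card (fibre 0)) :: complex"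
  have inner: "(\<Sum>u\<in>fibre 0. add_char z (a * u * (1 + y))) =
      (if y = -1 then ?k else 0) + (\<Sum>r<n. if 1 + y \<in> fibre r then period (s + r) else 0)" for y
  proof (cases "1 + y = 0")
    case True
    then have y: "y = -1" by (metis add_eq_0_iff)
    have "0 \<notin> fibre r" for r using fibre_nonzero by blast
    then show ?thesis unfolding y by (simp add: add_char_0[OF z])
  next
    case False
    obtain q where q: "q < n" "psi (1 + y) = om ^ q" "\<And>t. t < n \<Longrightarrow> psi (1 + y) = om ^ t \<longleftrightarrow> t = q"
      using psi_index[OF False] by metis
    have "psi (a * (1 + y)) = om ^ (s + q)" by (simp add: mult_char_mult[OF psi] a q(2) power_add)
    then have "(\<Sum>u\<in>fibre 0. add_char z (a * (1 + y) * u)) = period (s + q)"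
      using period_shift[of "a * (1 + y)" "s + q" 0] by simp
    moreover have "(\<Sum>r<n. if 1 + y \<in> fibre r then period (s + r) else 0) =
        (\<Sum>r<n. if r = q then period (s + r) else 0)"
      by (intro sum.cong refl) (simp add: fibre_def q(3))
    moreover have "y \<noteq> -1" using False by auto
    ultimately show ?thesis using q(1) by (simp add: mult_ac)
  qed
  have "period s * period (s + t) =
      (\<Sum>u\<in>fibre 0. add_char z (a * u) * (\<Sum>x\<in>fibre t. add_char z (a * x)))"
    using period_shift[OF a(2), of 0] by (simp add: period_shift[OF a(2)] sum_distrib_right)
  also have "\<dots> = (\<Sum>u\<in>fibre 0. \<Sum>y\<in>fibre t. add_char z (a * u * (1 + y)))"
  proof (rule sum.cong[OF refl])
    fix u assume "u \<in> fibre 0"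
    then have "psi u = om ^ 0" by (simp add: fibre_def)
    then have "(\<Sum>x\<in>fibre t. add_char z (a * x)) = (\<Sum>y\<in>fibre t. add_char z (a * (u * y)))"
      using sum_fibre_mult[of u 0 "\<lambda>x. add_char z (a * x)" t] by simp
    then show "add_char z (a * u) * (\<Sum>x\<in>fibre t. add_char z (a * x)) =
        (\<Sum>y\<in>fibre t. add_char z (a * u * (1 + y)))"
      by (simp add: sum_distrib_left distrib_left add_char_add[OF z] mult.assoc)
  qed
  also have "\<dots> = (\<Sum>y\<in>fibre t. (if y = -1 then ?k else 0) +
      (\<Sum>r<n. if 1 + y \<in> fibre r then period (s + r) else 0))"
    by (subst sum.swap) (simp only: inner)
  also have "\<dots> = (if -1 \<in> fibre t then ?k else 0) +
      (\<Sum>r<n. \<Sum>y\<in>fibre t. if 1 + y \<in> fibre r then period (s + r) else 0)"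
    unfolding sum.distrib by (subst sum.swap) (simp add: sum.delta)
  also have "(\<Sum>r<n. \<Sum>y\<in>fibre t. if 1 + y \<in> fibre r then period (s + r) else 0) =
      (\<Sum>r<n. of_nat (card (?N r)) * period (s + r))"
    by (intro sum.cong refl, subst sum.inter_filter [symmetric]) auto
  also have "(if -1 \<in> fibre t then ?k else 0) =
      (\<Sum>r<n. - (if -1 \<in> fibre t then ?k else 0) * period (s + r))"
    unfolding sum_distrib_left [symmetric] sum_period by simp
  also have "\<dots> + (\<Sum>r<n. of_nat (card (?N r)) * period (s + r)) =
      (\<Sum>r<n. of_int (structure_const t r) * period (s + r))"
    unfolding sum.distrib [symmetric]
    by (intro sum.cong refl) (simp add: structure_const_def algebra_simps)
  finally show ?thesis .
qed

text \<open>A characteristic polynomial of an integer matrix, hence monic with integer coefficients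
  from the start.\<close>

definition period_poly :: "int poly" where
  "period_poly = char_poly (mat n n (\<lambda>(t, r). structure_const t r))"

lemma degree_period_poly: "degree period_poly = n" "Polynomial.coeff period_poly n = 1"
  using degree_monic_char_poly[of "mat n n (\<lambda>(t, r). structure_const t r)" n]
  by (simp_all add: period_poly_def)

text \<open>By \<open>period_mult\<close> the shifted periods form an eigenvector for
  \<open>period s\<close>; it is nonzero because its entries sum to -1.\<close>

lemma period_poly_root: "poly (map_poly of_int period_poly) (period s) = 0"
proof -
  let ?A = "mat n n (\<lambda>(t, r). structure_const t r)"
  let ?B = "mat n n (\<lambda>(t, r). of_int (structure_const t r)) :: complex mat"
  let ?v = "vec n (\<lambda>r. period (s + r))"
  have "map_mat of_int ?A = ?B" by (rule eq_matI) auto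
  moreover have "char_poly (map_mat of_int ?A :: complex mat) = map_poly of_int (char_poly ?A)"
    by (rule of_int_hom.char_poly_hom[where n = n]) simp
  ultimately have cp: "map_poly of_int period_poly = char_poly ?B"
    by (simp only: period_poly_def)
  have "?B *\<^sub>v ?v = period s \<cdot>\<^sub>v ?v"
  proof (rule eq_vecI)
    fix t assume "t < dim_vec (period s \<cdot>\<^sub>v ?v)"
    then show "(?B *\<^sub>v ?v) $ t = (period s \<cdot>\<^sub>v ?v) $ t"
      by (simp add: scalar_prod_def period_mult lessThan_atLeast0)
  qed simp
  moreover have "?v \<noteq> 0\<^sub>v n"
  proof
    assume v: "?v = 0\<^sub>v n"
    have "period (s + t) = 0" if "t < n" for t
      using arg_cong[OF v, of "\<lambda>v. v $ t"] that by simp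
    then show False using sum_period[of s] by simp
  qed
  ultimately have "eigenvalue ?B (period s)"
    unfolding eigenvalue_def eigenvector_def by (intro exI[of _ ?v]) simp
  then show ?thesis
    unfolding cp using eigenvalue_root_char_poly[of ?B n] by simp
qed

text \<open>Exhibits periods as values of a rational polynomial at powers of \<open>z\<close>, so
  that \<open>poly_of_rat_root_power\<close> applies to them.\<close>

definition fibre_poly :: "nat \<Rightarrow> rat poly" where
  "fibre_poly t = (\<Sum>x\<in>fibre t. [:0, 1:] ^ nat (to_int_mod_ring x))"

lemma fibre_poly_eval:
  assumes "psi a = om ^ s"
  shows "poly (map_poly of_rat (fibre_poly t)) (add_char z a) = period (s + t)"
proof -
  interpret map_poly_comm_ring_hom "of_rat :: rat \<Rightarrow> complex" ..
  have "add_char z a ^ nat (to_int_mod_ring x) = add_char z (a * x)" for x :: "'p mod_ring"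
  proof -
    have "to_int_mod_ring x \<in> {0..<int CARD('p)}" using range_to_int_mod_ring[where 'a = 'p] by blast
    then have "of_nat (nat (to_int_mod_ring x)) = x"
      by (simp add: of_nat_of_int_mod_ring)
    then show ?thesis by (metis add_char_mult_of_nat[OF z])
  qed
  then show ?thesis
    by (simp add: fibre_poly_def hom_sum hom_power poly_sum period_shift[OF assms])
qed

lemma poly_of_rat_add_char:
  assumes "a \<noteq> 0" and "poly (map_poly of_rat Q) z = 0"
  shows "poly (map_poly of_rat Q) (add_char z (a :: 'p mod_ring)) = 0"
proof -
  have "CARD('p) > 1" by (rule prime_gt_1_nat[OF prime_card])
  then have "z ^ CARD('p) = 1" "z \<noteq> 1" using primitive_root_of_unityD[OF z] by auto
  moreover have "\<not> CARD('p) dvd nat (to_int_mod_ring a)"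
  proof
    assume dvd: "CARD('p) dvd nat (to_int_mod_ring a)"
    have "to_int_mod_ring a \<in> {0..<int CARD('p)}" using range_to_int_mod_ring[where 'a = 'p] by blast
    then have "nat (to_int_mod_ring a) < CARD('p)" "to_int_mod_ring a \<ge> 0" by auto
    then have "to_int_mod_ring a = 0" using dvd by (auto dest: dvd_imp_le)
    with assms(1) show False by simp
  qed
  ultimately show ?thesis
    unfolding add_char_def using assms(2) by (rule poly_of_rat_root_power)
qed

text \<open>Composing \<open>Q\<close> with \<open>fibre_poly 0\<close> gives a rational polynomial
  vanishing at \<open>z\<close>, hence at \<open>add_char z a\<close>, where it takes the value of
  \<open>Q\<close> at \<open>period s\<close>.\<close>

lemma poly_period_conjugate:
  assumes "poly (map_poly of_rat Q) (period 0) = 0"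
  shows "poly (map_poly of_rat Q) (period s) = 0"
proof -
  interpret map_poly_comm_ring_hom "of_rat :: rat \<Rightarrow> complex" ..
  obtain a where a: "a \<noteq> 0" "psi a = om ^ s" by (rule fibre_nonempty)
  have eval: "poly (map_poly of_rat (pcompose Q (fibre_poly 0))) (add_char z b) =
      poly (map_poly of_rat Q) (period t)" if "psi b = om ^ t" for b t
    using fibre_poly_eval[OF that, of 0] by (simp add: of_rat_hom.map_poly_pcompose poly_pcompose)
  have "psi 1 = om ^ 0" by (simp add: mult_char_1[OF psi])
  from eval[OF this] have "poly (map_poly of_rat (pcompose Q (fibre_poly 0))) z = 0"
    using assms by (simp add: add_char_1[OF z])
  then have "poly (map_poly of_rat (pcompose Q (fibre_poly 0))) (add_char z a) = 0"
    by (rule poly_of_rat_add_char[OF a(1)])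
  then show ?thesis using eval[OF a(2)] by simp
qed

text \<open>Equality of two periods is a rational relation for \<open>z\<close>, so it persists
  under all shifts. Shifting by \<open>i\<close> divides the Fourier coefficient \<open>gs 1\<close>
  by \<open>om ^ i\<close>; since \<open>gs 1\<close> is nonzero,
  \<open>om ^ i = om ^ j\<close>.\<close>

lemma inj_period: "inj_on period {..<n}"
proof (rule inj_onI)
  fix i j assume ij: "i \<in> {..<n}" "j \<in> {..<n}" and eq: "period i = period j"
  interpret map_poly_comm_ring_hom "of_rat :: rat \<Rightarrow> complex" ..
  have shift: "period (t + i) = period (t + j)" for t
  proof -
    obtain a where a: "a \<noteq> 0" "psi a = om ^ t" by (rule fibre_nonempty)
    have eval: "poly (map_poly of_rat (fibre_poly i - fibre_poly j)) (add_char z b) =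
        period (t + i) - period (t + j)" if "psi b = om ^ t" for b t
      using fibre_poly_eval[OF that] by (simp add: hom_minus)
    have "psi 1 = om ^ 0" by (simp add: mult_char_1[OF psi])
    from eval[OF this] have "poly (map_poly of_rat (fibre_poly i - fibre_poly j)) z = 0"
      using eq by (simp add: add_char_1[OF z])
    then have "poly (map_poly of_rat (fibre_poly i - fibre_poly j)) (add_char z a) = 0"
      by (rule poly_of_rat_add_char[OF a(1)])
    then show ?thesis using eval[OF a(2)] by simp
  qed
  have gs: "om ^ i * (\<Sum>t<n. om ^ t * period (t + i)) = gs 1" for i
  proof -
    obtain a where a: "a \<noteq> 0" "psi a = om ^ i" by (rule fibre_nonempty)
    have "(\<Sum>t<n. om ^ t * period (t + i)) = (\<Sum>t<n. om ^ (1 * t) * (\<Sum>x\<in>fibre t. add_char z (a * x)))"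
      by (simp add: period_shift[OF a(2)] add.commute[of _ i])
    also have "\<dots> = (\<Sum>x\<in>UNIV. pw 1 x * add_char z (a * x))" by (rule sum_fibres)
    finally have "om ^ i * (\<Sum>t<n. om ^ t * period (t + i)) =
        (\<Sum>x\<in>UNIV. om ^ i * (pw 1 x * add_char z (a * x)))"
      by (simp only: sum_distrib_left)
    also have "\<dots> = (\<Sum>x\<in>UNIV. pw 1 (a * x) * add_char z (a * x))"
      by (intro sum.cong refl) (simp add: a pw_def mult_char_mult[OF psi])
    also have "\<dots> = gs 1"
      unfolding gs_def gauss_sum_def using a(1) by (rule sum_mult_mod_ring)
    finally show ?thesis .
  qed
  have "\<not> n dvd 1" using n_gt_1 by simp
  then have "gs 1 \<noteq> 0" using gs_norm[of 1] by auto
  then have "(\<Sum>t<n. om ^ t * period (t + i)) \<noteq> 0" using gs[of i] by (metis mult_zero_right)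
  moreover have "om ^ i * (\<Sum>t<n. om ^ t * period (t + i)) = om ^ j * (\<Sum>t<n. om ^ t * period (t + i))"
    unfolding gs using gs[of j] by (simp only: shift)
  ultimately have "om ^ i = om ^ j" by simp
  then show "i = j" using ij om_power_inj by simp
qed

lemma period_poly_eq: "map_poly of_int period_poly = (\<Prod>t<n. [:- period t, 1:])"
  by (rule monic_eq_prod_linear) (simp_all add: degree_period_poly period_poly_root inj_period)

text \<open>A rational polynomial vanishing at \<open>period 0\<close> has all \<open>n\<close>
  distinct periods as roots, so its degree is at least \<open>n\<close>.\<close>

lemma is_min_poly_period: "is_min_poly (map_poly of_int period_poly) (period 0)"
  unfolding is_min_poly_def
proof (intro conjI allI impI)
  have comp: "map_poly of_rat (map_poly of_int period_poly) = (map_poly of_int period_poly :: complex poly)"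
    by (simp add: map_poly_map_poly o_def)
  show "lead_coeff (map_poly of_int period_poly :: rat poly) = 1"
    by (simp add: degree_period_poly)
  show "poly (map_poly of_rat (map_poly of_int period_poly)) (period 0) = 0"
    unfolding comp by (rule period_poly_root)
  fix Q :: "rat poly"
  assume Q: "Q \<noteq> 0 \<and> poly (map_poly of_rat Q) (period 0) = 0"
  let ?Q = "map_poly of_rat Q :: complex poly"
  have nz: "?Q \<noteq> 0" using Q by simp
  have "period ` {..<n} \<subseteq> {x. poly ?Q x = 0}" using Q poly_period_conjugate by auto
  then have "card (period ` {..<n}) \<le> card {x. poly ?Q x = 0}"
    by (rule card_mono[OF poly_roots_finite[OF nz]])
  also have "\<dots> \<le> degree ?Q" by (rule card_poly_roots_bound[OF nz])
  finally show "degree (map_poly of_int period_poly :: rat poly) \<le> degree Q"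
    by (simp add: degree_period_poly card_image[OF inj_period])
qed

lemma coeff_period_poly:
  "of_int (Polynomial.coeff period_poly 0) = (-1) ^ n * (\<Prod>t<n. period t)"
  "of_int (Polynomial.coeff period_poly 1) = (-1) ^ (n - 1) * (\<Sum>t<n. \<Prod>u\<in>{..<n} - {t}. period u)"
  using arg_cong[OF period_poly_eq, of "\<lambda>P. Polynomial.coeff P 0"]
    arg_cong[OF period_poly_eq, of "\<lambda>P. Polynomial.coeff P 1"]
  unfolding coeff_prod_linear by simp_all

end

section \<open>The Jacobi sum matrices\<close>

context power_residue_char
begin

lemma det_jacobi_mat_period_poly:
  "Determinant.det (mat n n (\<lambda>(i, j). gs i * gs j * cnj (gs (i + j)) / of_nat CARD('p) +
      (if i = 0 \<and> j = 0 then s else 0))) =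
    (- psi (-1)) ^ (n * (n - 1) div 2) * of_nat n ^ n *
    (s / of_nat n ^ 2 * of_int (Polynomial.coeff period_poly 1) -
      of_int (Polynomial.coeff period_poly 0) / of_nat CARD('p))"
proof -
  let ?p = "of_nat CARD('p) :: complex"
  define x y :: complex where "x = of_int (Polynomial.coeff period_poly 1)"
    and "y = of_int (Polynomial.coeff period_poly 0)"
  obtain m where m: "n = Suc m" using n_gt_1 by (cases n) auto
  have sgn: "(-1) ^ m * (-1) ^ m = (1 :: complex)" by (simp flip: power_mult_distrib)
  have "(\<Prod>t<n. period t) = - ((-1) ^ m * y)"
    using coeff_period_poly(1) sgn by (simp add: y_def m del: prod.lessThan_Suc)
  \<comment> \<open>Conjugation has no effect, since the coefficients are integers.\<close>
  then have "cnj (\<Prod>t<n. period t) = - ((-1) ^ m * y)" by (simp add: y_def)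
  then have y: "(\<Prod>t<n. cnj (period t) / ?p) = - ((-1) ^ m * y) / ?p ^ n"
    by (simp add: prod_dividef)
  have m1: "n - 1 = m" "n - 2 = m - 1" "n - Suc 0 = m" using m by auto
  have "(\<Sum>t<n. \<Prod>u\<in>{..<n} - {t}. period u) = (-1) ^ m * x"
    using coeff_period_poly(2) sgn by (simp add: x_def m del: sum.lessThan_Suc)
  then have "cnj (\<Sum>t<n. \<Prod>u\<in>{..<n} - {t}. period u) = (-1) ^ m * x" by (simp add: x_def)
  then have x: "(\<Sum>t<n. \<Prod>u\<in>{..<n} - {t}. cnj (period u) / ?p) = (-1) ^ m * x / ?p ^ m"
    by (simp add: prod_dividef m1 flip: sum_divide_distrib)
  \<comment> \<open>The sign from Vieta's formulas merges with the antidiagonal sign into the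
    exponent n(n-1)/2.\<close>
  have exp: "m + m * (m - 1) div 2 = n * m div 2" unfolding m by (cases m) auto
  have "(- psi (-1)) ^ (n * m div 2) = (-1) ^ (n * m div 2) * psi (-1) ^ (n * m div 2)"
    by (rule power_minus)
  also have "(-1) ^ (n * m div 2) = ((-1) ^ m * (-1) ^ (m * (m - 1) div 2) :: complex)"
    unfolding exp [symmetric] by (rule power_add)
  finally have sign: "(- psi (-1)) ^ (n * m div 2) =
      (-1) ^ m * (-1) ^ (m * (m - 1) div 2) * psi (-1) ^ (n * m div 2)" .
  have p_pow: "?p ^ n = ?p * ?p ^ m" by (simp add: m)
  have alg: "a * N * R * h * (- (b * y) / (q * R) + c * (b * x / R)) = b * a * h * N * (c * x - y / q)"
    if "R \<noteq> 0" "q \<noteq> 0" for a b c h N R q :: complex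
    using that by (simp add: field_simps)
  show ?thesis
    unfolding det_jacobi_mat x y x_def [symmetric] y_def [symmetric] m1 sign p_pow
    by (rule alg) simp_all
qed

text \<open>The slope of the affine function of \<open>s\<close> is read off as the difference of
  its values at 1 and 0.\<close>

lemma det_jacobi_minor_period_poly:
  "Determinant.det (mat (n - 1) (n - 1) (\<lambda>(i, j).
      gs (i + 1) * gs (j + 1) * cnj (gs ((i + 1) + (j + 1))) / of_nat CARD('p))) =
    (- psi (-1)) ^ (n * (n - 1) div 2) * of_nat n ^ (n - 2) * of_int (Polynomial.coeff period_poly 1)"
proof -
  let ?a = "\<lambda>i j. gs i * gs j * cnj (gs (i + j)) / of_nat CARD('p)"
  have corner: "Determinant.det (mat n n (\<lambda>(i, j). ?a i j + (if i = 0 \<and> j = 0 then s else 0))) =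
      Determinant.det (mat n n (\<lambda>(i, j). ?a i j)) +
      s * Determinant.det (mat (n - 1) (n - 1) (\<lambda>(i, j). ?a (i + 1) (j + 1)))" for s
    by (rule det_add_corner) (use n_gt_1 in simp)
  have "n = (n - 2) + 2" using n_gt_1 by simp
  then have "of_nat n ^ n = (of_nat n ^ (n - 2) * of_nat n ^ 2 :: complex)"
    by (metis power_add)
  moreover have difference: "X = L1 - L0" if "L1 = D + 1 * X" "L0 = D + 0 * X" for X D L0 L1 :: complex
    using that by simp
  moreover have "K * (M * c) * (1 / c * x - w) - K * (M * c) * (0 / c * x - w) = K * M * x"
    if "c \<noteq> 0" for K M c x w :: complex
    using that by (simp add: field_simps)
  moreover have "of_nat n ^ 2 \<noteq> (0 :: complex)" using n_gt_1 by simp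
  ultimately show ?thesis
    using difference[OF corner[of 1, unfolded det_jacobi_mat_period_poly] corner[of 0, unfolded det_jacobi_mat_period_poly]]
    by (simp only:)
qed

end

section \<open>Generators of the character group are faithful\<close>

lemma mod_ring_primitive_root:
  obtains \<gamma> :: "'p::prime_card mod_ring" where "\<And>i. \<gamma> ^ i = 1 \<longleftrightarrow> CARD('p) - 1 dvd i"
proof -
  have p: "prime CARD('p)" by (rule prime_card)
  then obtain g where "residue_primroot CARD('p) g"
    using prime_primitive_root_exists[of "CARD('p)"] prime_gt_1_nat by blast
  then have ord: "ord CARD('p) g = CARD('p) - 1" 
    using p by (simp add: residue_primroot_def totient_prime)
  have eq: "(of_nat a :: 'p mod_ring) = of_nat b \<longleftrightarrow> [a = b] (mod CARD('p))" for a b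
    using of_nat_eq_iff_cong_CHAR[where 'a = "'p mod_ring", of a b] by simp
  have "of_nat g ^ i = (1 :: 'p mod_ring) \<longleftrightarrow> CARD('p) - 1 dvd i" for i
    using eq[of "g ^ i" 1] ord_divides[of g i "CARD('p)"] ord by simp
  then show ?thesis by (rule that)
qed

text \<open>Via the discrete logarithm, the power of a primitive root \<gamma> with exponent
  \<open>i\<close> is sent to \<open>w ^ i\<close>, where \<open>w\<close> is a root of unity of
  exact order p - 1.\<close>

lemma faithful_mult_char:
  obtains A :: "'p::prime_card mod_ring \<Rightarrow> complex" where
    "mult_char A" "\<And>x. x \<noteq> 0 \<Longrightarrow> A x = 1 \<Longrightarrow> x = 1"
proof -
  obtain \<gamma> :: "'p mod_ring" where \<gamma>: "\<And>i. \<gamma> ^ i = 1 \<longleftrightarrow> CARD('p) - 1 dvd i"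
    using mod_ring_primitive_root by blast
  define m where "m = CARD('p) - 1"
  have m: "m > 0" using prime_gt_1_nat[OF prime_card[where 'a = 'p]] by (simp add: m_def)
  have \<gamma>0: "\<gamma> \<noteq> 0" using \<gamma>[of m] m by (auto simp: m_def power_0_left)
  define w where "w = cis (2 * pi / real m)"
  have wpow: "w ^ i = cis (2 * pi * real i / real m)" for i
    by (simp add: w_def DeMoivre mult_ac)
  have wm: "w ^ m = 1" using m by (simp add: wpow)
  have w_inj: "inj_on (\<lambda>i. w ^ i) {..<m}"
    unfolding wpow using bij_betw_roots_unity[OF m] by (simp add: bij_betw_def)
  have \<gamma>_inj: "inj_on (\<lambda>i. \<gamma> ^ i) {..<m}"
  proof (rule linorder_inj_onI)
    fix i j assume "i < j" and ij: "i \<in> {..<m}" "j \<in> {..<m}"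
    show "\<gamma> ^ i \<noteq> \<gamma> ^ j"
    proof
      assume "\<gamma> ^ i = \<gamma> ^ j"
      also have "\<dots> = \<gamma> ^ i * \<gamma> ^ (j - i)" using \<open>i < j\<close> by (simp flip: power_add)
      finally have "\<gamma> ^ (j - i) = 1" using \<gamma>0 by simp
      then have "m dvd j - i" using \<gamma> by (simp add: m_def)
      then show False using \<open>i < j\<close> ij by (auto dest: dvd_imp_le)
    qed
  qed auto
  have card: "card (- {0 :: 'p mod_ring}) = m" by (simp add: card_nonzero_mod_ring m_def)
  have "(\<lambda>i. \<gamma> ^ i) ` {..<m} = - {0}"
    by (rule card_subset_eq) (use \<gamma>0 in \<open>auto simp: card card_image[OF \<gamma>_inj]\<close>)
  then have log: "\<exists>i<m. x = \<gamma> ^ i" if "x \<noteq> 0" for x using that by blast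
  define dlog where "dlog x = (SOME i. i < m \<and> x = \<gamma> ^ i)" for x
  have dlog: "dlog x < m" "\<gamma> ^ dlog x = x" if "x \<noteq> 0" for x
    using someI_ex[OF log[OF that]] by (auto simp: dlog_def)
  define A where "A x = (if x = 0 then 0 else w ^ dlog x)" for x
  have mod: "\<gamma> ^ (i mod m) = \<gamma> ^ i" "w ^ (i mod m) = w ^ i" for i
  proof -
    have "\<gamma> ^ m = 1" using \<gamma> by (simp add: m_def)
    moreover have "\<gamma> ^ i = (\<gamma> ^ m) ^ (i div m) * \<gamma> ^ (i mod m)" by (simp flip: power_mult power_add)
    moreover have "w ^ i = (w ^ m) ^ (i div m) * w ^ (i mod m)" by (simp flip: power_mult power_add)
    ultimately show "\<gamma> ^ (i mod m) = \<gamma> ^ i" "w ^ (i mod m) = w ^ i" using wm by simp_all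
  qed
  have "mult_char A"
    unfolding mult_char_def
  proof (intro conjI allI impI)
    fix x y :: "'p mod_ring" assume xy: "x \<noteq> 0" "y \<noteq> 0"
    then have "\<gamma> ^ ((dlog x + dlog y) mod m) = \<gamma> ^ dlog (x * y)"
      by (simp add: mod(1) power_add dlog)
    then have "(dlog x + dlog y) mod m = dlog (x * y)"
      using \<gamma>_inj m dlog(1)[of "x * y"] xy by (auto simp: inj_on_def)
    then show "A (x * y) = A x * A y"
      using xy by (metis A_def mod(2) mult_eq_0_iff power_add)
  qed (auto simp: A_def w_def)
  moreover have "x = 1" if "x \<noteq> 0" "A x = 1" for x
  proof -
    have "w ^ dlog x = w ^ 0" using that by (simp add: A_def)
    then have "dlog x = 0" using w_inj m dlog(1)[OF that(1)] by (auto simp: inj_on_def)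
    then show ?thesis using dlog(2)[OF that(1)] by simp
  qed
  ultimately show ?thesis using that by blast
qed

lemma char_group_int_pow_eq_1:
  assumes "mult_char A" "x \<noteq> 0" "A x = 1"
  shows "(A [^]\<^bsub>char_group\<^esub> (m :: int)) x = 1"
proof -
  interpret comm_group "char_group :: ('a mod_ring \<Rightarrow> complex) monoid"
    by (rule comm_group_char_group)
  have A: "A \<in> carrier char_group" using assms(1) by (simp add: carrier_char_group)
  have pow: "(A [^]\<^bsub>char_group\<^esub> (i :: nat)) x = 1" for i
    using assms by (simp add: char_group_pow[OF A])
  show ?thesis
  proof (cases "m \<ge> 0")
    case True
    then show ?thesis using pow by (metis int_pow_def2 linorder_not_less)
  next
    case False
    let ?B = "A [^]\<^bsub>char_group\<^esub> nat (- m)"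
    have "inv\<^bsub>char_group\<^esub> ?B \<otimes>\<^bsub>char_group\<^esub> ?B = \<one>\<^bsub>char_group\<^esub>"
      by (rule l_inv[OF nat_pow_closed[OF A]])
    then have "(inv\<^bsub>char_group\<^esub> ?B \<otimes>\<^bsub>char_group\<^esub> ?B) x = \<one>\<^bsub>char_group\<^esub> x"
      by (rule arg_cong)
    moreover have "(B \<otimes>\<^bsub>char_group\<^esub> C) x = B x * C x" for B C :: "'a mod_ring \<Rightarrow> complex"
      by (simp add: char_group_def)
    moreover have "\<one>\<^bsub>char_group\<^esub> x = (1 :: complex)"
      using assms(2) by (simp add: char_group_def)
    ultimately have "(inv\<^bsub>char_group\<^esub> ?B) x = 1" by (simp only: pow mult_1_right)
    then show ?thesis using False by (metis int_pow_def2 linorder_not_less)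
  qed
qed

text \<open>Some faithful character is a power of \<open>chi\<close>, and a power is trivial
  wherever \<open>chi\<close> is.\<close>

lemma generator_faithful:
  fixes chi :: "'p::prime_card mod_ring \<Rightarrow> complex"
  assumes "generates_group char_group chi" "x \<noteq> 0" "chi x = 1"
  shows "x = 1"
proof -
  obtain A :: "'p mod_ring \<Rightarrow> complex" where A: "mult_char A" "\<And>x. x \<noteq> 0 \<Longrightarrow> A x = 1 \<Longrightarrow> x = 1"
    using faithful_mult_char by blast
  with assms(1) obtain m :: int where "A = chi [^]\<^bsub>char_group\<^esub> m" and "mult_char chi"
    by (auto simp: generates_group_char_group_iff)
  then show ?thesis using A(2) assms(2,3) char_group_int_pow_eq_1 by blast
qed

text \<open>Faithfulness makes \<open>chi\<close> injective on the p - 1 nonzero elements, and there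
  are just p - 1 roots of unity to hit.\<close>

lemma generator_range:
  fixes chi :: "'p::prime_card mod_ring \<Rightarrow> complex"
  assumes "generates_group char_group chi"
  shows "chi ` (- {0}) = {w. w ^ (CARD('p) - 1) = 1}"
proof (rule card_subset_eq)
  have chi: "mult_char chi" using assms by (simp add: generates_group_char_group_iff)
  have p: "CARD('p) - 1 > 0" using prime_gt_1_nat[OF prime_card[where 'a = 'p]] by simp
  show "finite {w :: complex. w ^ (CARD('p) - 1) = 1}" using p by (intro finite_roots_unity) simp
  show "chi ` (- {0}) \<subseteq> {w. w ^ (CARD('p) - 1) = 1}"
  proof clarify
    fix x :: "'p mod_ring" assume "x \<noteq> 0"
    have "chi x ^ (CARD('p) - 1) = chi (x ^ (CARD('p) - 1))"
      by (simp only: mult_char_power[OF chi])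
    then show "chi x ^ (CARD('p) - 1) = 1"
      by (simp only: mod_ring_power_card[OF \<open>x \<noteq> 0\<close>] mult_char_1[OF chi])
  qed
  have "inj_on chi (- {0})"
  proof (rule inj_onI)
    fix x y assume xy: "x \<in> - {0}" "y \<in> - {0}" "chi x = chi y"
    have "chi x = chi (x / y) * chi y" using xy mult_char_mult[OF chi, of "x / y" y] by simp
    moreover have "chi y \<noteq> 0" using xy chi by (simp add: mult_char_def)
    ultimately have "chi (x / y) = 1" using xy by simp
    then have "x / y = 1" using xy by (intro generator_faithful[OF assms]) auto
    then show "x = y" using xy by simp
  qed
  then show "card (chi ` (- {0})) = card {w :: complex. w ^ (CARD('p) - 1) = 1}"
    using p by (simp add: card_image card_nonzero_mod_ring card_roots_unity_eq)
qed

text \<open>The first two conjuncts ensure that the description operator in \<open>min_poly\<close>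
  denotes the minimal polynomial and that its coefficients are integers.\<close>

theorem theorem1p1:
  fixes chi :: "'p::prime_card mod_ring \<Rightarrow> complex"
    and \<zeta> :: complex
    and p k n :: nat
    and \<theta> x\<^sub>p y\<^sub>p :: complex
    and P :: "rat poly"
  assumes p: "p = CARD('p)" "p \<ge> 3"
    and k: "k dvd p - 1" "1 \<le> k" "k < p - 1"
    and n: "p - 1 = k * n"
    and gen: "generates_group char_group chi"
    and zeta: "primitive_root_of_unity p \<zeta>"
  defines "\<theta> \<equiv> gauss_period TYPE('p) \<zeta> k"
  defines "P \<equiv> min_poly \<theta>"
  defines "x\<^sub>p \<equiv> of_rat (Polynomial.coeff P 1)"
  defines "y\<^sub>p \<equiv> of_rat (Polynomial.coeff P 0)"
  shows "is_min_poly P \<theta> \<and> (\<forall>i. Polynomial.coeff P i \<in> \<int>) \<and>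
    Determinant.det (X_mat chi k n) =
      (-1) ^ (((k + 1) * (n^2 - n)) div 2) * of_nat n ^ (n - 2) * x\<^sub>p \<and>
    Determinant.det (Y_mat chi k n) =
      1 / of_nat p * (-1) ^ (((k + 1) * (n^2 - n)) div 2) * of_nat n ^ n
        * (of_nat k ^ 2 * x\<^sub>p - y\<^sub>p)"
proof -
  define psi where "psi = chi [^]\<^bsub>char_group\<^esub> k"
  have chi: "mult_char chi" using gen by (simp add: generates_group_char_group_iff)
  then have carrier: "chi \<in> carrier char_group" by (simp add: carrier_char_group)
  interpret G: comm_group "char_group :: ('p mod_ring \<Rightarrow> complex) monoid"
    by (rule comm_group_char_group)
  have psi: "mult_char psi"
    using G.nat_pow_closed[OF carrier, of k] by (simp add: psi_def carrier_char_group)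
  have psi_eq: "psi x = chi x ^ k" for x
    using k(2) by (simp add: psi_def char_group_pow[OF carrier])
  have n_gt_1: "n > 1"
    using k n by (metis One_nat_def less_irrefl less_one linorder_neqE_nat mult.right_neutral mult_0_right not_less0)
  interpret power_residue_char psi n \<zeta>
  proof
    show "primitive_root_of_unity CARD('p) \<zeta>" using zeta p(1) by simp
    show "psi ` (- {0}) = {w. w ^ n = 1}"
    proof (intro equalityI subsetI)
      fix w assume "w \<in> psi ` (- {0})"
      then obtain x where x: "x \<noteq> 0" "w = chi x ^ k" by (auto simp: psi_eq)
      have "chi x ^ (p - 1) = 1" using generator_range[OF gen] x(1) p(1) by blast
      then show "w \<in> {w. w ^ n = 1}" unfolding n by (simp add: x(2) power_mult)
    next
      fix w :: complex assume wn: "w \<in> {w. w ^ n = 1}"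
      then obtain t where w: "w = cis (2 * pi * real t / real n)"
        using bij_betw_roots_unity[of n] n_gt_1 by (auto simp: bij_betw_def)
      \<comment> \<open>A \<open>k\<close>-th root of \<open>w\<close>; it is a root of unity of
        order dividing p - 1, hence a value of \<open>chi\<close>.\<close>
      define v where "v = cis (2 * pi * real t / real (k * n))"
      have "v ^ k = w" using k(2) by (simp add: v_def w DeMoivre)
      moreover from this wn have "v ^ (k * n) = 1" by (simp add: power_mult)
      then have "v \<in> chi ` (- {0})" using generator_range[OF gen] n p(1) by simp
      ultimately show "w \<in> psi ` (- {0})" by (auto simp: psi_eq)
    qed
  qed (use psi n_gt_1 in auto)
  \<comment> \<open>This is where \<open>p\<close> being odd enters: faithfulness forces
    \<open>chi (-1) = -1\<close>, which fixes the sign of the determinants.\<close>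
  have "(-1 :: 'p mod_ring) \<noteq> 1"
  proof
    assume "(-1 :: 'p mod_ring) = 1"
    then have "(of_nat 2 :: 'p mod_ring) = 0" by (metis add_eq_0_iff2 of_nat_numeral one_add_one)
    then have "CARD('p) dvd 2" by (rule of_nat_0_mod_ring_dvd)
    then show False using p by (auto dest: dvd_imp_le)
  qed
  then have "chi (-1) \<noteq> 1" using generator_faithful[OF gen, of "-1"] by auto
  moreover have "chi (-1) * chi (-1) = 1"
    using mult_char_mult[OF chi, of "-1" "-1"] mult_char_1[OF chi] by simp
  ultimately have chi_m1: "chi (-1) = -1" by (metis square_eq_1_iff)
  then have psi_m1: "psi (-1) = (-1) ^ k" by (simp only: psi_eq chi_m1)
  have sign: "(- psi (-1)) ^ (n * (n - 1) div 2) = (-1) ^ (((k + 1) * (n^2 - n)) div 2)"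
  proof -
    \<comment> \<open>Since n(n-1) is even, the factor \<open>k + 1\<close> can be pulled out of the
      integer division.\<close>
    have "n^2 - n = n * (n - 1)" by (simp add: power2_eq_square diff_mult_distrib2)
    moreover have "even (n * (n - 1))" by (cases n) auto
    ultimately have "(k + 1) * (n^2 - n) div 2 = (k + 1) * (n * (n - 1) div 2)"
      by (simp only: div_mult_swap)
    moreover have "- psi (-1) = (-1) ^ (k + 1)" by (simp add: psi_m1)
    ultimately show ?thesis by (simp only: power_mult)
  qed
  \<comment> \<open>At 0 both sides vanish: for \<open>i = 0\<close> by the convention for the
    trivial character, otherwise because \<open>k * i\<close> is positive.\<close>
  have pow: "chi [^]\<^bsub>char_group\<^esub> (k * i) = pw i" for i
    using k(2) mult_char_0[OF chi]
    by (auto simp: fun_eq_iff char_group_pow[OF carrier] pw_def psi_eq power_mult power_0_left)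
  have "U_set k = fibre 0"
  proof -
    have "psi x = 1 \<longleftrightarrow> x ^ k = 1" if "x \<noteq> 0" for x
      using generator_faithful[OF gen, of "x ^ k"] mult_char_1[OF chi] that
      by (auto simp: psi_eq simp flip: mult_char_power[OF chi])
    moreover have "psi 0 \<noteq> 1" using mult_char_0[OF psi] by simp
    ultimately have "x \<in> U_set k \<longleftrightarrow> x \<in> fibre 0" for x
      by (cases "x = 0") (auto simp: U_set_def fibre_def)
    then show ?thesis by blast
  qed
  moreover have "\<zeta> powi to_int_mod_ring x = add_char \<zeta> x" for x :: "'p mod_ring"
  proof -
    have "to_int_mod_ring x \<in> {0..<int CARD('p)}" using range_to_int_mod_ring[where 'a = 'p] by blast
    then show ?thesis by (simp add: add_char_def power_int_def)
  qed
  ultimately have \<theta>: "\<theta> = period 0" by (simp add: \<theta>_def gauss_period_def period_def)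
  have P: "P = map_poly of_int period_poly"
    unfolding P_def \<theta> by (rule min_poly_eqI[OF is_min_poly_period])
  have xy: "x\<^sub>p = of_int (Polynomial.coeff period_poly 1)" "y\<^sub>p = of_int (Polynomial.coeff period_poly 0)"
    by (simp_all add: x\<^sub>p_def y\<^sub>p_def P)
  \<comment> \<open>All indices are at least 1 here, so the corner correction never occurs.\<close>
  have "X_mat chi k n = mat (n - 1) (n - 1) (\<lambda>(i, j).
      gs (i + 1) * gs (j + 1) * cnj (gs ((i + 1) + (j + 1))) / of_nat CARD('p))"
    unfolding X_mat_def pow by (rule eq_matI) (simp_all add: jacobi_sum_pw)
  then have X: "Determinant.det (X_mat chi k n) =
      (-1) ^ (((k + 1) * (n^2 - n)) div 2) * of_nat n ^ (n - 2) * x\<^sub>p"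
    unfolding xy sign [symmetric] by (simp only: det_jacobi_minor_period_poly)
  let ?s = "(of_nat CARD('p) - 1) ^ 2 / of_nat CARD('p) :: complex"
  have "Y_mat chi k n = mat n n (\<lambda>(i, j). gs i * gs j * cnj (gs (i + j)) / of_nat CARD('p) +
      (if i = 0 \<and> j = 0 then ?s else 0))"
    unfolding Y_mat_def pow by (rule eq_matI) (simp_all add: jacobi_sum_pw)
  then have "Determinant.det (Y_mat chi k n) = (- psi (-1)) ^ (n * (n - 1) div 2) * of_nat n ^ n *
      (?s / of_nat n ^ 2 * x\<^sub>p - y\<^sub>p / of_nat CARD('p))"
    unfolding xy by (simp only: det_jacobi_mat_period_poly)
  \<comment> \<open>With p - 1 = kn the coefficient \<open>?s / of_nat n ^ 2\<close> becomes k^2 /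
    p.\<close>
  also have "of_nat CARD('p) - 1 = (of_nat k * of_nat n :: complex)"
  proof -
    have "of_nat (p - 1) = (of_nat k * of_nat n :: complex)" unfolding n by simp
    then show ?thesis using p by (simp add: of_nat_diff)
  qed
  finally have Y: "Determinant.det (Y_mat chi k n) =
      1 / of_nat p * (-1) ^ (((k + 1) * (n^2 - n)) div 2) * of_nat n ^ n * (of_nat k ^ 2 * x\<^sub>p - y\<^sub>p)"
    unfolding sign using n_gt_1 by (simp add: p(1) field_simps power_mult_distrib)
  have "is_min_poly P \<theta>" unfolding P \<theta> by (rule is_min_poly_period)
  moreover have "\<forall>i. Polynomial.coeff P i \<in> \<int>" by (simp add: P)
  ultimately show ?thesis using X Y by blast
qed

end
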